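(* Let $\mathcal{A}_{\mathfrak{q}}(Q)$ be the Kronecker quantum cluster algebra with principal coefficients over an indeterminate $\mathfrak{q}$, and let $$\mathcal{S}=\{\text{cluster monomials}\}\sqcup\{S_n \mid n\geq 1\}.$$ Then $\mathcal{S}$ is a bar-invariant positive $\mathbb{Z}[\mathfrak{q}^{\pm\frac12}][y_1^{\pm},y_2^{\pm}]$-basis of $\mathcal{A}_{\mathfrak{q}}(Q)$; that is, $\mathcal{S}$ is a basis of $\mathcal{A}_{\mathfrak{q}}(Q)$ over $\mathbb{Z}[\mathfrak{q}^{\pm\frac12}][y_1^{\pm},y_2^{\pm}]$, every element of $\mathcal{S}$ is invariant under the bar-involution, and the structure constants of $\mathcal{S}$ belong to $\mathbb{Z}_{\geq 0}[\mathfrak{q}^{\pm\frac12}][y_1^{\pm},y_2^{\pm}]$.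
   Context: Let $\mathfrak{q}$ be an indeterminate. Let $\Lambda$ be the skew-symmetric bilinear form on $\mathbb{Z}^4$ (natural basis $e_1,\dots,e_4$) with $\Lambda(e_1,e_3)=-1$, $\Lambda(e_2,e_4)=-1$, $\Lambda(e_3,e_4)=-2$, $\Lambda(e_1,e_2)=\Lambda(e_1,e_4)=\Lambda(e_2,e_3)=0$. The quantum torus $\mathcal{T}_{\mathfrak q}$ is the $\mathbb{Z}[\mathfrak{q}^{\pm 1/2}]$-algebra with basis $\{X^{e}: e\in\mathbb{Z}^4\}$ and product $X^{e}X^{f}=\mathfrak{q}^{\Lambda(e,f)/2}X^{e+f}$; $\mathcal{F}_{\mathfrak q}$ is its skew-field of fractions. The bar-involution is the $\mathbb{Z}$-linear map with $\overline{\mathfrak{q}^{r/2}X^e}=\mathfrak{q}^{-r/2}X^e$. Let $\widetilde{B}$ be the $4\times2$ matrix with rows $(0,2),(-2,0),(1,0),(0,1)$. The initial quantum seed is $(\Lambda,\widetilde B,X)$ with $X=\{X_1,\dots,X_4\}$, $X_i=X^{e_i}$. For a quantum seed $(\Lambda,\widetilde B=(b_{ij}),X)$, write $X^a=\mathfrak{q}^{-\frac12\sum_{i<j}a_ia_j\Lambda_{ij}}X_1^{a_1}X_2^{a_2}X_3^{a_3}X_4^{a_4}$ for $a\in\mathbb{Z}^4$. For $k\in\{1,2\}$ its mutation in direction $k$ is $(\Lambda',\widetilde B',X')$ with: $\Lambda'=E^{tr}\Lambda E$, where $e_{ij}=\delta_{ij}$ if $j\neq k$, $e_{kk}=-1$,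 $e_{ik}=[-b_{ik}]_+$ for $i\neq k$; $b'_{ij}=-b_{ij}$ if $i=k$ or $j=k$, and $b'_{ij}=b_{ij}+[b_{ik}]_+b_{kj}+b_{ik}[-b_{kj}]_+$ otherwise; $X'_i=X_i$ for $i\neq k$ and $X'_k=X^{\sum_j[b_{jk}]_+e_j-e_k}+X^{\sum_j[-b_{jk}]_+e_j-e_k}$. Here $[a]_+=\max\{0,a\}$. For every seed obtained from the initial one by finitely many mutations, its first two elements $\{X'_1,X'_2\}$ form a cluster, whose elements are cluster variables. Cluster monomials are the elements $X'^{(a_1,a_2,0,0)}$ with $a_1,a_2\in\mathbb{Z}_{\ge0}$, for all such seeds. The coefficients are $y_1=X^{(0,0,1,0)}$, $y_2=X^{(0,0,0,1)}$ (they lie in every seed). $\mathbb{Z}[\mathfrak{q}^{\pm1/2}][y_1^{\pm},y_2^{\pm}]$ denotes the ring of Laurent polynomials in the ($\mathfrak q$-commuting) elements $y_1,y_2$ inside $\mathcal{T}_{\mathfrak q}$, and $\mathbb{Z}_{\ge0}[\mathfrak{q}^{\pm1/2}][y_1^{\pm},y_2^{\pm}]$ the subset of those with coefficients in $\mathbb{Z}_{\geq0}[\mathfrak q^{\pm1/2}]$. $\mathcal{A}_{\mathfrak q}(Q)$ is the $\mathbb{Z}[\mathfrak{q}^{\pm1/2}][y_1^{\pm},y_2^{\pm}]$-subalgebra of $\mathcal{F}_{\mathfrak q}$ generated by all cluster variables. "Basis over $\mathbb{Z}[\mathfrak{q}^{\pm1/2}][y_1^{\pm},y_2^{\pm}]$"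 is understood with coefficients multiplied on the left; the structure constants of a basis are the coefficients of products of two basis elements expanded in the basis. Let $X_\delta=X^{(1,-1,1,1)}+X^{(-1,-1,1,0)}+X^{(-1,1,0,0)}$. Define $S_0=1$, $S_1=X_\delta$, $S_2=S_1S_1-X^{(0,0,1,1)}$, and $S_{n+1}=S_nS_1-X^{(0,0,1,1)}S_{n-1}$ for $n\ge 2$. *)

theory Defs
  imports "HOL-Library.Poly_Mapping" "HOL-Library.Product_Plus"
begin

section \<open>The quantum torus\<close>

type_synonym z4 = "int \<times> int \<times> int \<times> int"

text \<open>Components are numbered from 1 to 4; the value 0 elsewhere is never used.\<close>

fun coord :: "z4 \<Rightarrow> nat \<Rightarrow> int" where
  "coord (a1, a2, a3, a4) i =
     (if i = 1 then a1 else if i = 2 then a2 else if i = 3 then a3 else if i = 4 then a4 else 0)"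

definition Lam0 :: "nat \<Rightarrow> nat \<Rightarrow> int" where
  "Lam0 i j =
     (if (i, j) = (1, 3) then -1 else if (i, j) = (3, 1) then 1
      else if (i, j) = (2, 4) then -1 else if (i, j) = (4, 2) then 1
      else if (i, j) = (3, 4) then -2 else if (i, j) = (4, 3) then 2
      else 0)"

definition Lam_form :: "z4 \<Rightarrow> z4 \<Rightarrow> int" where
  "Lam_form e f = (\<Sum>i\<in>{1..4}. \<Sum>j\<in>{1..4}. coord e i * Lam0 i j * coord f j)"

text \<open>\<open>QMon r e\<close> stands for the monomial \<open>q\<^sup>r\<^sup>/\<^sup>2 X\<^sup>e\<close>.  These monomials form a group, written
  additively because the product of \<open>HOL-Library.Poly_Mapping\<close> convolves over an additive
  monoid; the group is not commutative.\<close>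

datatype qmon = QMon (qexp: int) (vexp: z4)

instantiation qmon :: monoid_add
begin

definition zero_qmon :: qmon where "0 = QMon 0 0"

definition plus_qmon :: "qmon \<Rightarrow> qmon \<Rightarrow> qmon" where
  "m + n = QMon (qexp m + qexp n + Lam_form (vexp m) (vexp n)) (vexp m + vexp n)"

lemma coord_add: "coord (e + f) i = coord e i + coord f i"
  by (cases e; cases f) auto

lemma coord_zero: "coord 0 i = 0"
  by (simp add: zero_prod_def)

lemma Lam_form_add_left: "Lam_form (e + e') f = Lam_form e f + Lam_form e' f"
  by (simp add: Lam_form_def coord_add algebra_simps sum.distrib)

lemma Lam_form_add_right: "Lam_form e (f + f') = Lam_form e f + Lam_form e f'"
  by (simp add: Lam_form_def coord_add algebra_simps sum.distrib)

lemma Lam_form_zero: "Lam_form 0 f = 0" "Lam_form e 0 = 0"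
  by (simp_all add: Lam_form_def coord_zero)

instance
  by standard
    (auto simp: zero_qmon_def plus_qmon_def Lam_form_add_left Lam_form_add_right Lam_form_zero
      add.assoc)

end

text \<open>A free \<open>\<int>[q\<^sup>\<plusminus>\<^sup>1\<^sup>/\<^sup>2]\<close>-module with basis the \<open>X\<^sup>e\<close> is a free abelian group with basis the
  \<open>q\<^sup>r\<^sup>/\<^sup>2 X\<^sup>e\<close>, so the quantum torus is the integral monoid ring of \<^typ>\<open>qmon\<close>.\<close>

type_synonym qtorus = "qmon \<Rightarrow>\<^sub>0 int"

definition qhalf :: "int \<Rightarrow> qtorus" where  \<comment> \<open>\<open>q\<^sup>r\<^sup>/\<^sup>2\<close>\<close>
  "qhalf r = Poly_Mapping.single (QMon r 0) 1"

definition Xmon :: "z4 \<Rightarrow> qtorus" where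
  "Xmon e = Poly_Mapping.single (QMon 0 e) 1"

lemma qhalf_0: "qhalf 0 = 1"
  by (simp add: qhalf_def flip: zero_qmon_def)

lemma qhalf_mult: "qhalf r * qhalf s = qhalf (r + s)"
  by (simp add: qhalf_def mult_single plus_qmon_def Lam_form_zero)

lemma qhalf_Xmon: "qhalf r * Xmon e = Poly_Mapping.single (QMon r e) 1"
  by (simp add: qhalf_def Xmon_def mult_single plus_qmon_def Lam_form_zero)

lemma qhalf_Xmon_commute: "Xmon e * qhalf r = qhalf r * Xmon e"
  by (simp add: qhalf_def Xmon_def mult_single plus_qmon_def Lam_form_zero)

lemma Xmon_mult: "Xmon e * Xmon f = qhalf (Lam_form e f) * Xmon (e + f)"
  unfolding qhalf_Xmon by (simp add: Xmon_def mult_single plus_qmon_def)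

text \<open>The \<open>\<int>\<close>-linear map \<open>q\<^sup>r\<^sup>/\<^sup>2 X\<^sup>e \<mapsto> q\<^sup>-\<^sup>r\<^sup>/\<^sup>2 X\<^sup>e\<close>.\<close>

definition bar :: "qtorus \<Rightarrow> qtorus" where
  "bar p = (\<Sum>m\<in>Poly_Mapping.keys p.
     Poly_Mapping.single (QMon (- qexp m) (vexp m)) (Poly_Mapping.lookup p m))"

text \<open>Laurent polynomials in \<open>y\<^sub>1, y\<^sub>2\<close>, where \<open>y\<^sub>1 = Xmon (0,0,1,0)\<close> and \<open>y\<^sub>2 = Xmon (0,0,0,1)\<close>.
  The ordered monomial \<open>y\<^sub>1\<^sup>a y\<^sub>2\<^sup>b\<close> is a power of \<open>q\<^sup>1\<^sup>/\<^sup>2\<close> times \<open>Xmon (0,0,a,b)\<close>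
  (lemma \<open>y_monomial\<close>), so both give the same Laurent polynomials and the same nonnegative ones.\<close>

lemma y_monomial: "Xmon (0, 0, a, 0) * Xmon (0, 0, 0, b) = qhalf (-2 * a * b) * Xmon (0, 0, a, b)"
proof -
  have "{1..4} = {1, 2, 3, 4::nat}" by auto
  then have "Lam_form (0, 0, a, 0) (0, 0, 0, b) = -2 * a * b"
    by (simp add: Lam_form_def Lam0_def)
  then show ?thesis by (simp add: Xmon_mult)
qed

definition coeff_ring :: "qtorus set" where
  "coeff_ring = {p. \<forall>m\<in>Poly_Mapping.keys p. coord (vexp m) 1 = 0 \<and> coord (vexp m) 2 = 0}"

definition coeff_ring_nonneg :: "qtorus set" where
  "coeff_ring_nonneg = {p \<in> coeff_ring. \<forall>m. Poly_Mapping.lookup p m \<ge> 0}"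


section \<open>Skew-field of fractions\<close>

text \<open>\<open>\<iota>\<close> exhibits the division ring \<open>'f\<close> as a skew-field of fractions of \<open>'a\<close>.\<close>

definition skew_field_of_fractions :: "('a::ring_1 \<Rightarrow> 'f::division_ring) \<Rightarrow> bool" where
  "skew_field_of_fractions \<iota> \<longleftrightarrow>
     \<iota> 1 = 1 \<and> (\<forall>a b. \<iota> (a + b) = \<iota> a + \<iota> b) \<and> (\<forall>a b. \<iota> (a * b) = \<iota> a * \<iota> b) \<and> inj \<iota> \<and>
     (\<forall>z. \<exists>a b. b \<noteq> 0 \<and> z = \<iota> a * inverse (\<iota> b)) \<and>
     (\<forall>z. \<exists>a b. b \<noteq> 0 \<and> z = inverse (\<iota> b) * \<iota> a)"


section \<open>Quantum seeds and mutation\<close>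

text \<open>A seed \<open>(\<Lambda>, B, X)\<close>: rows are numbered 1 to 4, columns of \<open>B\<close> are 1 and 2.  Only these
  entries are ever used.\<close>

type_synonym 'f seed = "(nat \<Rightarrow> nat \<Rightarrow> int) \<times> (nat \<Rightarrow> nat \<Rightarrow> int) \<times> (nat \<Rightarrow> 'f)"

definition pos :: "int \<Rightarrow> int" where
  "pos a = max 0 a"

definition seed_monomial ::
  "(qtorus \<Rightarrow> 'f::division_ring) \<Rightarrow> (nat \<Rightarrow> nat \<Rightarrow> int) \<Rightarrow> (nat \<Rightarrow> 'f) \<Rightarrow> (nat \<Rightarrow> int) \<Rightarrow> 'f" where
  "seed_monomial \<iota> L X a =
     \<iota> (qhalf (- (\<Sum>i\<in>{1..4}. \<Sum>j\<in>{i<..4}. a i * a j * L i j))) *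
     (X 1 powi a 1 * X 2 powi a 2 * X 3 powi a 3 * X 4 powi a 4)"

definition mutation_E :: "(nat \<Rightarrow> nat \<Rightarrow> int) \<Rightarrow> nat \<Rightarrow> nat \<Rightarrow> nat \<Rightarrow> int" where
  "mutation_E B k i j =
     (if j \<noteq> k then (if i = j then 1 else 0) else if i = k then -1 else pos (- B i k))"

definition mutate_Lam ::
  "(nat \<Rightarrow> nat \<Rightarrow> int) \<Rightarrow> (nat \<Rightarrow> nat \<Rightarrow> int) \<Rightarrow> nat \<Rightarrow> nat \<Rightarrow> nat \<Rightarrow> int" where
  "mutate_Lam L B k i j =
     (\<Sum>r\<in>{1..4}. \<Sum>s\<in>{1..4}. mutation_E B k r i * L r s * mutation_E B k s j)"

definition mutate_B :: "(nat \<Rightarrow> nat \<Rightarrow> int) \<Rightarrow> nat \<Rightarrow> nat \<Rightarrow> nat \<Rightarrow> int" where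
  "mutate_B B k i j =
     (if i = k \<or> j = k then - B i j else B i j + pos (B i k) * B k j + B i k * pos (- B k j))"

definition mutate_X ::
  "(qtorus \<Rightarrow> 'f::division_ring) \<Rightarrow> (nat \<Rightarrow> nat \<Rightarrow> int) \<Rightarrow> (nat \<Rightarrow> nat \<Rightarrow> int) \<Rightarrow> (nat \<Rightarrow> 'f) \<Rightarrow>
     nat \<Rightarrow> nat \<Rightarrow> 'f" where
  "mutate_X \<iota> L B X k =
     X(k := seed_monomial \<iota> L X (\<lambda>j. pos (B j k) - (if j = k then 1 else 0)) +
            seed_monomial \<iota> L X (\<lambda>j. pos (- B j k) - (if j = k then 1 else 0)))"

definition B0 :: "nat \<Rightarrow> nat \<Rightarrow> int" where
  "B0 i j =
     (if (i, j) = (1, 2) then 2 else if (i, j) = (2, 1) then -2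
      else if (i, j) = (3, 1) then 1 else if (i, j) = (4, 2) then 1 else 0)"

definition X0 :: "(qtorus \<Rightarrow> 'f::division_ring) \<Rightarrow> nat \<Rightarrow> 'f" where
  "X0 \<iota> i = \<iota> (Xmon (of_bool (i = 1), of_bool (i = 2), of_bool (i = 3), of_bool (i = 4)))"

inductive_set seeds :: "(qtorus \<Rightarrow> 'f::division_ring) \<Rightarrow> 'f seed set"
  for \<iota> :: "qtorus \<Rightarrow> 'f::division_ring" where
  initial: "(Lam0, B0, X0 \<iota>) \<in> seeds \<iota>"
| mutation: "(L, B, X) \<in> seeds \<iota> \<Longrightarrow> k \<in> {1, 2} \<Longrightarrow>
    (mutate_Lam L B k, mutate_B B k, mutate_X \<iota> L B X k) \<in> seeds \<iota>"

definition cluster_variables :: "(qtorus \<Rightarrow> 'f::division_ring) \<Rightarrow> 'f set" where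
  "cluster_variables \<iota> = {X i | L B X i. (L, B, X) \<in> seeds \<iota> \<and> i \<in> {1, 2}}"

definition cluster_monomials :: "(qtorus \<Rightarrow> 'f::division_ring) \<Rightarrow> 'f set" where
  "cluster_monomials \<iota> =
     {seed_monomial \<iota> L X (coord (int a1, int a2, 0, 0)) | L B X a1 a2. (L, B, X) \<in> seeds \<iota>}"

text \<open>The quantum cluster algebra.  The coefficients need not commute with the cluster
  variables, so the subalgebra generated is the subring generated together with
  \<^const>\<open>coeff_ring\<close>; closure under negation follows from \<open>-1 \<in> coeff_ring\<close>.\<close>

inductive_set cluster_algebra :: "(qtorus \<Rightarrow> 'f::division_ring) \<Rightarrow> 'f set"
  for \<iota> :: "qtorus \<Rightarrow> 'f::division_ring" where
  coeff: "c \<in> coeff_ring \<Longrightarrow> \<iota> c \<in> cluster_algebra \<iota>"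
| variable: "x \<in> cluster_variables \<iota> \<Longrightarrow> x \<in> cluster_algebra \<iota>"
| add: "x \<in> cluster_algebra \<iota> \<Longrightarrow> y \<in> cluster_algebra \<iota> \<Longrightarrow> x + y \<in> cluster_algebra \<iota>"
| mult: "x \<in> cluster_algebra \<iota> \<Longrightarrow> y \<in> cluster_algebra \<iota> \<Longrightarrow> x * y \<in> cluster_algebra \<iota>"


section \<open>The elements \<open>S\<^sub>n\<close>\<close>

definition X_delta :: qtorus where
  "X_delta = Xmon (1, -1, 1, 1) + Xmon (-1, -1, 1, 0) + Xmon (-1, 1, 0, 0)"

fun Sn :: "nat \<Rightarrow> qtorus" where
  "Sn 0 = 1"
| "Sn (Suc 0) = X_delta"
| "Sn (Suc (Suc n)) = Sn (Suc n) * Sn (Suc 0) - Xmon (0, 0, 1, 1) * Sn n"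

definition basis_S :: "(qtorus \<Rightarrow> 'f::division_ring) \<Rightarrow> 'f set" where
  "basis_S \<iota> = cluster_monomials \<iota> \<union> {\<iota> (Sn n) | n. n \<ge> 1}"


section \<open>Bases with coefficients on the left\<close>

definition left_coeffs :: "'a::zero set \<Rightarrow> 'f set \<Rightarrow> ('f \<Rightarrow>\<^sub>0 'a) set" where
  "left_coeffs R B = {c. Poly_Mapping.keys c \<subseteq> B \<and> (\<forall>s\<in>B. Poly_Mapping.lookup c s \<in> R)}"

definition left_comb :: "('a::zero \<Rightarrow> 'f::ring_1) \<Rightarrow> ('f \<Rightarrow>\<^sub>0 'a) \<Rightarrow> 'f" where
  "left_comb \<iota> c = (\<Sum>s\<in>Poly_Mapping.keys c. \<iota> (Poly_Mapping.lookup c s) * s)"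

definition is_left_basis ::
  "('a::zero \<Rightarrow> 'f::ring_1) \<Rightarrow> 'a set \<Rightarrow> 'f set \<Rightarrow> 'f set \<Rightarrow> bool" where
  "is_left_basis \<iota> R B A \<longleftrightarrow>
     B \<subseteq> A \<and> left_comb \<iota> ` left_coeffs R B = A \<and>
     (\<forall>c\<in>left_coeffs R B. left_comb \<iota> c = 0 \<longrightarrow> c = 0)"

text \<open>The bar-involution is a map on the quantum torus, so bar-invariance of an element of the
  skew-field includes that it lies in the quantum torus.\<close>

definition bar_invariant :: "(qtorus \<Rightarrow> 'f::division_ring) \<Rightarrow> 'f \<Rightarrow> bool" where
  "bar_invariant \<iota> x \<longleftrightarrow> (\<exists>p. \<iota> p = x \<and> bar p = p)"

text \<open>For a basis \<open>B\<close>, the set of all structure constants: the coefficients of the products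
  \<open>s * t\<close> of basis elements.\<close>

definition structure_constants ::
  "('a::zero \<Rightarrow> 'f::ring_1) \<Rightarrow> 'a set \<Rightarrow> 'f set \<Rightarrow> 'a set" where
  "structure_constants \<iota> R B =
     {Poly_Mapping.lookup c u | c s t u.
        s \<in> B \<and> t \<in> B \<and> u \<in> B \<and> c \<in> left_coeffs R B \<and> left_comb \<iota> c = s * t}"

end

theory Submission
  imports Defs
begin

text \<open>
  All cluster variables lie on a line: they are elements \<open>x\<^sub>m\<close>, \<open>m \<in> \<int>\<close>, the clusters are the pairs
  \<open>{x\<^sub>m, x\<^sub>m\<^sub>+\<^sub>1}\<close>, and \<open>x\<^sub>m\<close> and \<open>x\<^sub>m\<^sub>+\<^sub>1\<close> commute.  After rescaling \<open>x\<^sub>m\<close> for \<open>m \<le> 0\<close> by a Laurent monomial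
  in \<open>y\<^sub>1, y\<^sub>2\<close>, they become one two-sided solution \<open>z\<^sub>m\<close> of the linear recursion
  \<open>X\<^sub>\<delta> z\<^sub>m = z\<^sub>m\<^sub>+\<^sub>1 + H z\<^sub>m\<^sub>-\<^sub>1\<close> with \<open>H = X\<^sup>(\<^sup>0\<^sup>,\<^sup>0\<^sup>,\<^sup>1\<^sup>,\<^sup>1\<^sup>)\<close>, whose coefficients also define the \<open>S\<^sub>n\<close>.  Everything
  multiplicative follows from this recursion by the classical manipulations of Casoratians and
  Chebyshev polynomials:

    \<open>z\<^sub>p z\<^sub>p\<^sub>+\<^sub>n\<^sub>+\<^sub>2 = z\<^sub>p\<^sub>+\<^sub>1 z\<^sub>p\<^sub>+\<^sub>n\<^sub>+\<^sub>1 + u S\<^sub>n\<close> with a unit \<open>u\<close> (\<open>zvar_mult_far\<close>),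
    \<open>S\<^sub>n\<^sub>+\<^sub>1 z\<^sub>m = z\<^sub>m\<^sub>+\<^sub>n\<^sub>+\<^sub>1 + H S\<^sub>n z\<^sub>m\<^sub>-\<^sub>1\<close> (\<open>Sn_zvar\<close>),
    \<open>S\<^sub>m\<^sub>+\<^sub>1 S\<^sub>n\<^sub>+\<^sub>1 = S\<^sub>m\<^sub>+\<^sub>n\<^sub>+\<^sub>2 + H S\<^sub>m S\<^sub>n\<close> (\<open>Sn_mult_Sn\<close>).

  \<^emph>\<open>Positivity.\<close>  The three identities have nonnegative coefficients.  Used as rewriting rules they
  straighten any product: the first moves two distant variables one step towards each other at the
  price of a term of smaller degree, the second lets a variable absorb an \<open>S\<^sub>n\<close>.  Hence products of
  two elements of the basis are nonnegative combinations (\<open>standard_mult\<close>).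

  \<^emph>\<open>Spanning.\<close>  The combinations form a subring, because a coefficient can be moved past a basis
  element at the price of powers of \<open>q\<close>.  It contains the variables, so it is the cluster algebra; and
  \<open>X\<^sub>\<delta>\<close> lies in the cluster algebra because the first identity with \<open>n = 1\<close> can be solved for it.

  \<^emph>\<open>Independence.\<close>  Modulo positive powers of \<open>y\<^sub>1, y\<^sub>2\<close> every basis element is a single monomial
  \<open>X\<^sup>g\<close> with \<open>g \<in> \<int>\<^sup>2\<close>, and \<open>g\<close> determines the element (\<open>standard_pointed\<close>).  The terms of lowest degree
  in \<open>y\<^sub>1, y\<^sub>2\<close> of a linear relation therefore cannot cancel (\<open>standard_independent\<close>).

  \<^emph>\<open>Bar-invariance.\<close>  The bar-involution is an antiautomorphism, and the recursion holds with \<open>X\<^sub>\<delta>\<close>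
  on either side.

  The link with seeds is \<open>is_seed\<close>: it gives the quantum seed with cluster \<open>{x\<^sub>n, x\<^sub>n\<^sub>+\<^sub>1}\<close> in closed form,
  and its two mutations are the seeds for \<open>n + 1\<close> and \<open>n - 1\<close>.
\<close>


section \<open>Arithmetic in the quantum torus\<close>

abbreviation Ymon :: "int \<Rightarrow> int \<Rightarrow> qtorus" where
  "Ymon c d \<equiv> Xmon (0, 0, c, d)"

lemma qtorus_induct [case_names single add]:
  fixes p :: qtorus
  assumes single: "\<And>r e n. P (Poly_Mapping.single (QMon r e) n)"
    and add: "\<And>p q. P p \<Longrightarrow> P q \<Longrightarrow> P (p + q)"
  shows "P p"
proof (induction p rule: update_induct)
  case const
  show ?case using single[of 0 0 0] by simp
next
  case (update f m n)
  have "Poly_Mapping.update m n f = f + Poly_Mapping.single m n"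
    using update(1) by (intro poly_mapping_eqI)
      (auto simp: lookup_update lookup_add lookup_single when_def in_keys_iff)
  then show ?case
    using add[OF update(3) single[of "qexp m" "vexp m" n]] by simp
qed

lemma Lam_form_explicit [simp]:
  "Lam_form (a1, a2, a3, a4) (b1, b2, b3, b4) =
     a3 * b1 - a1 * b3 + a4 * b2 - a2 * b4 + 2 * a4 * b3 - 2 * a3 * b4"
proof -
  have "{1..4} = {1, 2, 3, 4::nat}" by auto
  then show ?thesis by (simp add: Lam_form_def Lam0_def)
qed

lemma Lam_form_swap: "Lam_form f e = - Lam_form e f"
  by (cases e; cases f) simp

lemma qhalf_central: "p * qhalf r = qhalf r * p"
proof (induction p rule: qtorus_induct)
  case (single s e n)
  show ?case by (simp add: qhalf_def mult_single plus_qmon_def Lam_form_zero add.commute)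
qed (simp add: algebra_simps)

lemma qhalf_central_assoc: "p * (qhalf r * s) = qhalf r * (p * s)"
  by (metis mult.assoc qhalf_central)

lemma qhalf_mult_assoc: "qhalf r * (qhalf s * p) = qhalf (r + s) * p"
  by (simp add: qhalf_mult flip: mult.assoc)

lemma Xmon_zero: "Xmon (0, 0, 0, 0) = 1"
  by (simp add: Xmon_def zero_qmon_def zero_prod_def flip: single_one)

lemma Xmon_mult_assoc: "Xmon e * (Xmon f * p) = qhalf (Lam_form e f) * (Xmon (e + f) * p)"
  by (simp add: Xmon_mult flip: mult.assoc)

text \<open>Together these bring a product to the form power of \<open>q\<^sup>1\<^sup>/\<^sup>2\<close> times monomial times rest.  The
  centrality of \<open>q\<close> is instantiated to monomials on the left, since in general form it loops on
  products of powers of \<open>q\<close>.\<close>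

lemmas torus_simps = qhalf_central[of "Xmon e" for e] qhalf_central_assoc[of "Xmon e" for e]
  qhalf_mult qhalf_mult_assoc Xmon_mult Xmon_mult_assoc qhalf_0 Xmon_zero mult.assoc

lemma qhalf_cancel: "qhalf r * p = qhalf r * s \<longleftrightarrow> p = s"
  by (metis mult_1 qhalf_0 qhalf_mult_assoc add.left_inverse)

lemma Ymon_cancel: "Ymon c d * p = Ymon c d * s \<longleftrightarrow> p = s"
proof
  assume "Ymon c d * p = Ymon c d * s"
  then have "Ymon (-c) (-d) * (Ymon c d * p) = Ymon (-c) (-d) * (Ymon c d * s)" by simp
  then show "p = s" by (simp add: torus_simps)
qed simp

lemma bar_lookup: "Poly_Mapping.lookup (bar p) m = Poly_Mapping.lookup p (QMon (- qexp m) (vexp m))"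
proof -
  have "Poly_Mapping.lookup (bar p) m =
    (\<Sum>k\<in>Poly_Mapping.keys p. if k = QMon (- qexp m) (vexp m) then Poly_Mapping.lookup p k else 0)"
    unfolding bar_def lookup_sum
    by (intro sum.cong refl) (auto simp: lookup_single when_def qmon.expand)
  also have "\<dots> = Poly_Mapping.lookup p (QMon (- qexp m) (vexp m))"
    by (auto simp: sum.delta in_keys_iff)
  finally show ?thesis .
qed

lemma bar_add: "bar (p + s) = bar p + bar s"
  by (intro poly_mapping_eqI) (simp add: bar_lookup lookup_add)

lemma bar_diff: "bar (p - s) = bar p - bar s"
  by (intro poly_mapping_eqI) (simp add: bar_lookup lookup_minus)

lemma bar_single: "bar (Poly_Mapping.single (QMon r e) n) = Poly_Mapping.single (QMon (- r) e) n"
  by (intro poly_mapping_eqI) (auto simp: bar_lookup lookup_single when_def qmon.expand)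

text \<open>The form \<open>\<Lambda>\<close> is skew-symmetric, so inverting \<open>q\<close> has the same effect on a product of monomials as
  exchanging the factors.\<close>

lemma bar_mult: "bar (p * s) = bar s * bar p"
proof (induction p rule: qtorus_induct)
  case (single r e n)
  show ?case
  proof (induction s rule: qtorus_induct)
    case (single r' e' n')
    show ?case
      by (simp add: bar_single mult_single plus_qmon_def Lam_form_swap[of e' e] add.commute
          mult.commute)
  qed (simp add: algebra_simps bar_add)
qed (simp add: algebra_simps bar_add)

lemma bar_qhalf [simp]: "bar (qhalf r) = qhalf (- r)"
  by (simp add: qhalf_def bar_single)

lemma bar_Xmon [simp]: "bar (Xmon e) = Xmon e"
  by (simp add: Xmon_def bar_single)

lemma bar_one: "bar 1 = 1"
  using bar_qhalf[of 0] by (simp add: qhalf_0)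

text \<open>In terms of exponents: every \<open>X\<^sup>e\<close> occurring in \<open>p\<close> has \<open>\<Lambda>(e\<^sub>3, e) = \<alpha>\<close> and \<open>\<Lambda>(e\<^sub>4, e) = \<beta>\<close>.  Both
  \<open>\<Lambda>(e\<^sub>3, -)\<close> and \<open>\<Lambda>(e\<^sub>4, -)\<close> vanish on the columns of the exchange matrix, which is why the cluster
  variables are homogeneous.  Coefficients can be moved past a homogeneous element.\<close>

definition homogeneous :: "int \<Rightarrow> int \<Rightarrow> qtorus \<Rightarrow> bool" where
  "homogeneous \<alpha> \<beta> p \<longleftrightarrow>
     (\<forall>c d. Ymon c d * p = qhalf (2 * (c * \<alpha> + d * \<beta>)) * (p * Ymon c d))"

lemma homogeneous_add: "homogeneous \<alpha> \<beta> p \<Longrightarrow> homogeneous \<alpha> \<beta> s \<Longrightarrow> homogeneous \<alpha> \<beta> (p + s)"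
  by (simp add: homogeneous_def algebra_simps)

lemma homogeneous_diff: "homogeneous \<alpha> \<beta> p \<Longrightarrow> homogeneous \<alpha> \<beta> s \<Longrightarrow> homogeneous \<alpha> \<beta> (p - s)"
  by (simp add: homogeneous_def algebra_simps)

lemma homogeneous_mult:
  assumes "homogeneous \<alpha> \<beta> p" "homogeneous \<alpha>' \<beta>' s"
  shows "homogeneous (\<alpha> + \<alpha>') (\<beta> + \<beta>') (p * s)"
  unfolding homogeneous_def
proof (intro allI)
  fix c d
  have "Ymon c d * (p * s) = qhalf (2 * (c * \<alpha> + d * \<beta>)) * (p * (Ymon c d * s))"
    using assms(1) by (simp add: homogeneous_def flip: mult.assoc)
  also have "\<dots> = qhalf (2 * (c * \<alpha> + d * \<beta>)) * (p * (qhalf (2 * (c * \<alpha>' + d * \<beta>')) * (s * Ymon c d)))"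
    using assms(2) by (simp add: homogeneous_def)
  finally show "Ymon c d * (p * s) =
      qhalf (2 * (c * (\<alpha> + \<alpha>') + d * (\<beta> + \<beta>'))) * (p * s * Ymon c d)"
    by (simp add: qhalf_central_assoc[of p] qhalf_mult_assoc mult.assoc algebra_simps)
qed

lemma homogeneous_Xmon: "homogeneous (a - 2 * d) (b + 2 * c) (Xmon (a, b, c, d))"
  by (simp add: homogeneous_def torus_simps algebra_simps)

lemma homogeneous_qhalf: "homogeneous 0 0 (qhalf r)"
  by (simp add: homogeneous_def qhalf_central[of "Xmon e" for e] qhalf_0)

lemma homogeneous_one: "homogeneous 0 0 1"
  using homogeneous_qhalf[of 0] by (simp add: qhalf_0)

lemma homogeneous_swap:
  assumes "homogeneous \<alpha> \<beta> p"
  shows "p * Ymon c d = qhalf (- 2 * (c * \<alpha> + d * \<beta>)) * (Ymon c d * p)"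
proof -
  have "Ymon c d * p = qhalf (2 * (c * \<alpha> + d * \<beta>)) * (p * Ymon c d)"
    using assms unfolding homogeneous_def by blast
  then show ?thesis by (simp add: qhalf_mult_assoc qhalf_0)
qed


section \<open>Products of the variables and the elements \<open>S\<^sub>n\<close>\<close>

text \<open>The coefficient of the recursion that governs both the \<open>S\<^sub>n\<close> and the cluster variables.  It commutes
  with \<open>X\<^sub>\<delta>\<close>, but only up to a power of \<open>q\<close> with the variables.\<close>

abbreviation H :: qtorus where
  "H \<equiv> Ymon 1 1"

lemma homogeneous_X_delta: "homogeneous (-1) 1 X_delta"
  unfolding X_delta_def
  using homogeneous_Xmon[of 1 1 "-1" 1] homogeneous_Xmon[of "-1" 0 "-1" 1]
    homogeneous_Xmon[of "-1" 0 1 0]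
  by (intro homogeneous_add) auto

lemma H_X_delta: "H * X_delta = X_delta * H"
  using homogeneous_X_delta by (simp add: homogeneous_def qhalf_0)

lemma bar_X_delta: "bar X_delta = X_delta"
  by (simp add: X_delta_def bar_add)

lemma homogeneous_Sn: "homogeneous (- int n) (int n) (Sn n)"
proof (induction n rule: induct_nat_012)
  case 0
  show ?case by (simp add: homogeneous_one)
next
  case 1
  show ?case by (simp add: homogeneous_X_delta)
next
  case (ge2 n)
  have "homogeneous (- 2 - int n) (2 + int n) (H * Sn n)"
    using homogeneous_mult[OF homogeneous_Xmon[of 0 1 0 1] ge2(1)] by simp
  moreover have "homogeneous (- 2 - int n) (2 + int n) (Sn (Suc n) * X_delta)"
    using homogeneous_mult[OF ge2(2) homogeneous_X_delta] by (simp add: algebra_simps)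
  ultimately have "homogeneous (- 2 - int n) (2 + int n) (Sn (Suc n) * X_delta - H * Sn n)"
    by (rule homogeneous_diff[rotated])
  moreover have "- 2 - int n = - int (Suc (Suc n))" "2 + int n = int (Suc (Suc n))"
    by simp_all
  ultimately show ?case by (simp only: Sn.simps)
qed

lemma H_Sn: "H * Sn n = Sn n * H"
  using homogeneous_Sn[of n] by (simp add: homogeneous_def qhalf_0)

lemma commute_assoc: "a * b = b * a \<Longrightarrow> a * (b * c) = b * (a * c)" for a :: "'a::semigroup_mult"
  by (metis mult.assoc)

lemma Sn_X_delta: "Sn n * X_delta = X_delta * Sn n"
proof (induction n rule: induct_nat_012)
  case (ge2 n)
  then show ?case
    by (simp add: algebra_simps H_X_delta[symmetric] commute_assoc[OF H_X_delta[symmetric]]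
      commute_assoc[OF ge2(2)])
qed simp_all

text \<open>A normal form for words in the commuting elements: powers of \<open>q\<^sup>1\<^sup>/\<^sup>2\<close>, then \<open>H\<close>, then \<open>X\<^sub>\<delta>\<close>, then the
  \<open>S\<^sub>n\<close>.\<close>

lemmas front_simps = H_X_delta[symmetric] commute_assoc[OF H_X_delta[symmetric]]
  H_Sn[symmetric] commute_assoc[OF H_Sn[symmetric]] Sn_X_delta commute_assoc[OF Sn_X_delta]
  qhalf_central_assoc[of X_delta] qhalf_central[of X_delta]
  qhalf_central_assoc[of "Sn n" for n] qhalf_central[of "Sn n" for n]

lemma Sn_Suc_Suc: "Sn (Suc (Suc n)) = X_delta * Sn (Suc n) - H * Sn n"
  by (simp add: Sn_X_delta)

lemma bar_Sn: "bar (Sn n) = Sn n"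
  by (induction n rule: induct_nat_012)
    (simp_all add: bar_one bar_X_delta bar_diff bar_mult front_simps)

text \<open>This is the recursion \<open>U\<^sub>m U\<^sub>n = U\<^sub>m\<^sub>+\<^sub>n + U\<^sub>m\<^sub>-\<^sub>1 U\<^sub>n\<^sub>-\<^sub>1\<close> of the Chebyshev polynomials of the
  second kind; both sides satisfy the defining recursion in \<open>n\<close>.\<close>

lemma Sn_mult_Sn: "Sn (Suc m) * Sn (Suc n) = Sn (Suc m + Suc n) + H * (Sn m * Sn n)"
proof (induction n rule: induct_nat_012)
  case 0
  then show ?case by (simp add: algebra_simps)
next
  case 1
  then show ?case
    by (simp add: algebra_simps front_simps)
next
  case (ge2 n)
  have "Sn (Suc m) * Sn (Suc (Suc (Suc n))) =
      Sn (Suc m) * Sn (Suc (Suc n)) * X_delta - H * (Sn (Suc m) * Sn (Suc n))"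
    by (simp only: Sn.simps algebra_simps front_simps)
  also have "\<dots> = Sn (Suc (Suc (Suc (Suc (m + n))))) + H * (Sn m * Sn (Suc n) * X_delta - H * (Sn m * Sn n))"
    unfolding ge2 by (simp add: algebra_simps front_simps)
  also have "Sn m * Sn (Suc n) * X_delta - H * (Sn m * Sn n) = Sn m * Sn (Suc (Suc n))"
    by (simp add: algebra_simps front_simps)
  finally show ?case by simp
qed

text \<open>The rescaled cluster variables, as a solution of \<open>X\<^sub>\<delta> z\<^sub>m = z\<^sub>m\<^sub>+\<^sub>1 + H z\<^sub>m\<^sub>-\<^sub>1\<close> that is run upwards and
  downwards from \<open>z\<^sub>1 = X\<^sub>1\<close>.  With \<open>z\<^sub>2 = X\<^sub>2\<close>, the recursion at \<open>m = 1\<close> forces the value of \<open>z\<^sub>0\<close>, which is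
  the variable obtained by mutating the initial seed in direction 2, divided by \<open>y\<^sub>2\<close> up to a power of
  \<open>q\<close>.\<close>

fun zvar_up :: "nat \<Rightarrow> qtorus" where
  "zvar_up 0 = Xmon (1, 0, 0, 0)"
| "zvar_up (Suc 0) = Xmon (0, 1, 0, 0)"
| "zvar_up (Suc (Suc n)) = X_delta * zvar_up (Suc n) - H * zvar_up n"

fun zvar_down :: "nat \<Rightarrow> qtorus" where
  "zvar_down 0 = Xmon (1, 0, 0, 0)"
| "zvar_down (Suc 0) = Xmon (0, -1, 0, -1) + Xmon (2, -1, 0, 0)"
| "zvar_down (Suc (Suc n)) = Ymon (-1) (-1) * (X_delta * zvar_down (Suc n) - zvar_down n)"

definition zvar :: "int \<Rightarrow> qtorus" where
  "zvar m = (if m \<ge> 1 then zvar_up (nat (m - 1)) else zvar_down (nat (1 - m)))"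

lemma zvar_1: "zvar 1 = Xmon (1, 0, 0, 0)"
  by (simp add: zvar_def)

lemma zvar_2: "zvar 2 = Xmon (0, 1, 0, 0)"
  by (simp add: zvar_def)

lemma zvar_0: "zvar 0 = Xmon (0, -1, 0, -1) + Xmon (2, -1, 0, 0)"
  by (simp add: zvar_def)

lemma X_delta_zvar: "X_delta * zvar m = zvar (m + 1) + H * zvar (m - 1)"
proof -
  consider "m \<ge> 2" | "m = 1" | "m \<le> 0" by linarith
  then show ?thesis
  proof cases
    case 1
    define n where "n = nat (m - 2)"
    have "nat (m - 1) = Suc n" "nat m = Suc (Suc n)" "nat (m - 2) = n"
      using 1 by (auto simp: n_def)
    then show ?thesis using 1 by (simp add: zvar_def)
  next
    case 2
    then show ?thesis by (simp add: zvar_def X_delta_def algebra_simps torus_simps)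
  next
    case 3
    define n where "n = nat (- m)"
    have "nat (1 - m) = Suc n" "nat (2 - m) = Suc (Suc n)" "nat (- m) = n"
      using 3 by (auto simp: n_def)
    moreover have "zvar (m + 1) = zvar_down n"
      using 3 by (auto simp: zvar_def n_def)
    ultimately show ?thesis using 3 by (simp add: zvar_def torus_simps)
  qed
qed

lemma zvar_next: "zvar (m + 2) = X_delta * zvar (m + 1) - H * zvar m"
  using X_delta_zvar[of "m + 1"] by (simp add: algebra_simps)

lemma zvar_prev: "zvar m = Ymon (-1) (-1) * (X_delta * zvar (m + 1) - zvar (m + 2))"
  using zvar_next[of m] by (simp add: torus_simps)

lemma zvar_induct [case_names 1 2 up down]:
  assumes "P (1::int)" "P 2"
    and "\<And>m. P m \<Longrightarrow> P (m + 1) \<Longrightarrow> P (m + 2)" "\<And>m. P (m + 1) \<Longrightarrow> P (m + 2) \<Longrightarrow> P m"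
  shows "P m"
proof -
  have "P m \<and> P (m + 1)"
  proof (induction m rule: int_induct[where k = 1])
    case (step1 i)
    then show ?case using assms(3)[of i] by (simp add: algebra_simps)
  next
    case (step2 i)
    then show ?case using assms(4)[of "i - 1"] by (simp add: algebra_simps)
  qed (use assms in auto)
  then show ?thesis ..
qed

lemma homogeneous_zvar: "homogeneous (2 - m) (m - 1) (zvar m)"
proof (induction m rule: zvar_induct)
  case 1
  show ?case using homogeneous_Xmon[of 1 0 0 0] by (simp add: zvar_1)
next
  case 2
  show ?case using homogeneous_Xmon[of 0 0 1 0] by (simp add: zvar_2)
next
  case (up m)
  have "homogeneous (2 - (m + 2)) (m + 2 - 1) (X_delta * zvar (m + 1))"
    using homogeneous_mult[OF homogeneous_X_delta up(2)] by (simp add: algebra_simps)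
  moreover have "homogeneous (2 - (m + 2)) (m + 2 - 1) (H * zvar m)"
    using homogeneous_mult[OF homogeneous_Xmon[of 0 1 0 1] up(1)] by (simp add: algebra_simps)
  ultimately show ?case unfolding zvar_next by (rule homogeneous_diff)
next
  case (down m)
  have "homogeneous (- m) (m + 1) (X_delta * zvar (m + 1))"
    using homogeneous_mult[OF homogeneous_X_delta down(1)] by (simp add: algebra_simps)
  moreover have "homogeneous (- m) (m + 1) (zvar (m + 2))"
    using down(2) by (simp add: algebra_simps)
  ultimately have "homogeneous (- m) (m + 1) (X_delta * zvar (m + 1) - zvar (m + 2))"
    by (rule homogeneous_diff)
  from homogeneous_mult[OF homogeneous_Xmon[of 0 "-1" 0 "-1"] this]
  show ?case unfolding zvar_prev[of m] by (simp add: algebra_simps)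
qed

lemma H_zvar: "H * zvar m = qhalf 2 * (zvar m * H)"
  using homogeneous_zvar[of m] by (simp add: homogeneous_def)

lemma zvar_H: "zvar m * H = qhalf (-2) * (H * zvar m)"
  by (simp add: H_zvar qhalf_mult_assoc qhalf_0)

lemma zvar_Hinv: "zvar m * Ymon (-1) (-1) = qhalf 2 * (Ymon (-1) (-1) * zvar m)"
  using homogeneous_swap[OF homogeneous_zvar[of m], of "-1" "-1"] by (simp add: algebra_simps)

text \<open>The mirror image of the defining recursion.  Both sides solve the defining recursion, because \<open>H\<close>
  and \<open>X\<^sub>\<delta>\<close> commute, and they agree for \<open>m = 1, 2\<close>.  Having the recursion on both sides makes the \<open>z\<^sub>m\<close>
  bar-invariant and the Casoratians below computable.\<close>

lemma zvar_X_delta: "zvar m * X_delta = zvar (m + 1) + qhalf (-2) * (H * zvar (m - 1))"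
proof (induction m rule: zvar_induct)
  case 1
  show ?case
    by (simp add: zvar_1 zvar_2 zvar_0 X_delta_def algebra_simps torus_simps)
next
  case 2
  have "zvar 3 = X_delta * zvar 2 - H * zvar 1"
    using zvar_next[of 1] by simp
  then show ?case
    by (simp add: zvar_1 zvar_2 X_delta_def algebra_simps torus_simps)
next
  case (up m)
  have "zvar (m + 2) * X_delta =
      X_delta * (zvar (m + 1) * X_delta) - H * (zvar m * X_delta)"
    by (simp add: zvar_next algebra_simps)
  also have "\<dots> = (X_delta * zvar (m + 2) - H * zvar (m + 1)) +
      qhalf (-2) * (H * (X_delta * zvar m - H * zvar (m - 1)))"
    unfolding up by (simp add: algebra_simps torus_simps front_simps)
  also have "X_delta * zvar m - H * zvar (m - 1) = zvar (m + 1)"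
    using X_delta_zvar[of m] by simp
  also have "X_delta * zvar (m + 2) - H * zvar (m + 1) = zvar (m + 3)"
    using X_delta_zvar[of "m + 2"] by (simp add: algebra_simps)
  finally show ?case by (simp add: algebra_simps)
next
  case (down m)
  have "zvar m * X_delta = Ymon (-1) (-1) *
      (X_delta * (zvar (m + 1) * X_delta) - zvar (m + 2) * X_delta)"
    by (simp add: zvar_prev[of m] algebra_simps)
  also have "X_delta * (zvar (m + 1) * X_delta) - zvar (m + 2) * X_delta =
      (X_delta * zvar (m + 2) - zvar (m + 3)) +
      qhalf (-2) * (H * (X_delta * zvar m - zvar (m + 1)))"
    unfolding down by (simp add: algebra_simps torus_simps front_simps)
  also have "X_delta * zvar m - zvar (m + 1) = H * zvar (m - 1)"
    using X_delta_zvar[of m] by simp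
  also have "X_delta * zvar (m + 2) - zvar (m + 3) = H * zvar (m + 1)"
    using X_delta_zvar[of "m + 2"] by (simp add: algebra_simps)
  finally show ?case by (simp add: torus_simps algebra_simps)
qed

lemma bar_zvar: "bar (zvar m) = zvar m"
proof (induction m rule: zvar_induct)
  case (up m)
  have "bar (zvar (m + 2)) = zvar (m + 1) * X_delta - zvar m * H"
    by (simp add: zvar_next bar_diff bar_mult bar_X_delta up)
  then show ?case by (simp add: zvar_X_delta zvar_H algebra_simps)
next
  case (down m)
  have "bar (zvar m) = (zvar (m + 1) * X_delta - zvar (m + 2)) * Ymon (-1) (-1)"
    unfolding zvar_prev[of m] by (simp add: bar_diff bar_mult bar_X_delta down)
  then show ?case
    by (simp add: zvar_X_delta torus_simps algebra_simps zvar_Hinv)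
qed (simp_all add: zvar_1 zvar_2)

text \<open>The Casoratian \<open>z\<^sub>p z\<^sub>r\<^sub>+\<^sub>1 - z\<^sub>p\<^sub>+\<^sub>1 z\<^sub>r\<close> of two shifts of the sequence changes only by a unit when both
  are shifted once more, as for any linear recursion of order 2: expand the left factor by the
  right-hand recursion and the right factor by the left-hand one, and the terms with \<open>X\<^sub>\<delta>\<close> cancel.\<close>

lemma casoratian_shift:
  "zvar (p + 1) * zvar (r + 2) - zvar (p + 2) * zvar (r + 1) =
     qhalf (-2) * (H * (zvar p * zvar (r + 1) - zvar (p + 1) * zvar r))"
proof -
  have "zvar (p + 2) = zvar (p + 1) * X_delta - qhalf (-2) * (H * zvar p)"
    using zvar_X_delta[of "p + 1"] by (simp add: algebra_simps)
  then have "zvar (p + 1) * zvar (r + 2) - zvar (p + 2) * zvar (r + 1) =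
      zvar (p + 1) * (X_delta * zvar (r + 1) - H * zvar r) -
      (zvar (p + 1) * X_delta - qhalf (-2) * (H * zvar p)) * zvar (r + 1)"
    by (simp add: zvar_next)
  also have "\<dots> = qhalf (-2) * (H * (zvar p * zvar (r + 1))) - zvar (p + 1) * H * zvar r"
    by (simp add: algebra_simps)
  finally show ?thesis by (simp add: zvar_H algebra_simps)
qed

text \<open>The commutator is a Casoratian, and it vanishes for the initial pair.\<close>

lemma zvar_commute: "zvar m * zvar (m + 1) = zvar (m + 1) * zvar m"
proof -
  note step = casoratian_shift[of k k for k]
  have "zvar m * zvar (m + 1) - zvar (m + 1) * zvar m = 0"
  proof (induction m rule: int_induct[where k = 1])
    case base
    then show ?case by (simp add: zvar_1 zvar_2 torus_simps)
  next
    case (step1 i)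
    then show ?case using step[of i] by (simp add: add.commute)
  next
    case (step2 i)
    then have "qhalf (-2) * (H * (zvar (i - 1) * zvar i - zvar i * zvar (i - 1))) = qhalf (-2) * (H * 0)"
      using step[of "i - 1"] by (simp add: add.commute)
    then show ?case by (simp only: qhalf_cancel Ymon_cancel) simp
  qed
  then show ?thesis by simp
qed

text \<open>In its second index alone the Casoratian satisfies the recursion of the \<open>S\<^sub>n\<close>.\<close>

lemma casoratian_recursion:
  "zvar p * zvar (r + 2) - zvar (p + 1) * zvar (r + 1) =
     (zvar p * zvar (r + 1) - zvar (p + 1) * zvar r) * X_delta -
     (zvar p * zvar r - zvar (p + 1) * zvar (r - 1)) * H"
proof -
  have "zvar (r + 2) = zvar (r + 1) * X_delta - zvar r * H"
    using zvar_X_delta[of "r + 1"] by (simp add: algebra_simps zvar_H)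
  moreover have "zvar (r + 1) = zvar r * X_delta - zvar (r - 1) * H"
    using zvar_X_delta[of r] by (simp add: algebra_simps zvar_H)
  ultimately have "zvar p * zvar (r + 2) - zvar (p + 1) * zvar (r + 1) =
      zvar p * (zvar (r + 1) * X_delta - zvar r * H) -
      zvar (p + 1) * (zvar r * X_delta - zvar (r - 1) * H)"
    by (simp only:)
  then show ?thesis by (simp add: algebra_simps)
qed

text \<open>The Casoratian of neighbours is the quantum exchange relation; its value is transported from the
  initial seed, where it is \<open>q\<^sup>-\<^sup>1\<^sup>/\<^sup>2 y\<^sub>1\<close>.\<close>

lemma zvar_exchange:
  "zvar p * zvar (p + 2) = zvar (p + 1) * zvar (p + 1) + qhalf (-1) * Ymon p (p - 1)"
proof -
  have "zvar p * zvar (p + 2) - zvar (p + 1) * zvar (p + 1) = qhalf (-1) * Ymon p (p - 1)"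
  proof (induction p rule: int_induct[where k = 1])
    case base
    have "zvar 3 = X_delta * zvar 2 - H * zvar 1"
      using zvar_next[of 1] by simp
    then show ?case
      by (simp add: zvar_1 zvar_2 X_delta_def algebra_simps torus_simps)
  next
    case (step1 i)
    then show ?case
      using casoratian_shift[of i "i + 1"] by (simp add: torus_simps algebra_simps)
  next
    case (step2 i)
    have "qhalf (-2) * (H * (zvar (i - 1) * zvar (i + 1) - zvar i * zvar i)) =
        qhalf (-2) * (H * (qhalf (-1) * Ymon (i - 1) (i - 2)))"
      using casoratian_shift[of "i - 1" i] step2 by (simp add: torus_simps algebra_simps)
    then show ?case
      by (simp only: qhalf_cancel Ymon_cancel) (simp add: algebra_simps)
  qed
  then show ?thesis by (simp add: algebra_simps)
qed

text \<open>The Casoratians for \<open>n = -1\<close> (a commutator, hence 0) and \<open>n = 0\<close> (the exchange relation) are the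
  initial values of the \<open>S\<^sub>n\<close> up to a unit, and the recursion in \<open>n\<close> is the same.\<close>

lemma zvar_mult_far:
  "zvar p * zvar (p + int n + 2) =
     zvar (p + 1) * zvar (p + int n + 1) + qhalf (-1) * (Ymon p (p - 1) * Sn n)"
proof -
  have "zvar p * zvar (p + int n + 2) - zvar (p + 1) * zvar (p + int n + 1) =
     qhalf (-1) * (Ymon p (p - 1) * Sn n)"
  proof (induction n rule: induct_nat_012)
    case 0
    show ?case using zvar_exchange[of p] by simp
  next
    case 1
    have "zvar p * zvar (p + 3) - zvar (p + 1) * zvar (p + 2) =
        (zvar p * zvar (p + 2) - zvar (p + 1) * zvar (p + 1)) * X_delta -
        (zvar p * zvar (p + 1) - zvar (p + 1) * zvar p) * H"
      using casoratian_recursion[of p "p + 1"] by (simp add: add.commute)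
    also have "\<dots> = qhalf (-1) * Ymon p (p - 1) * X_delta"
      using zvar_exchange[of p] by (simp add: zvar_commute)
    finally show ?case by (simp add: mult.assoc add.commute)
  next
    case (ge2 n)
    have "zvar p * zvar (p + int n + 4) - zvar (p + 1) * zvar (p + int n + 3) =
      (zvar p * zvar (p + int n + 3) - zvar (p + 1) * zvar (p + int n + 2)) * X_delta -
      (zvar p * zvar (p + int n + 2) - zvar (p + 1) * zvar (p + int n + 1)) * H"
      using casoratian_recursion[of p "p + int n + 2"] by (simp add: add_ac)
    also have "zvar p * zvar (p + int n + 3) - zvar (p + 1) * zvar (p + int n + 2) =
        qhalf (-1) * (Ymon p (p - 1) * Sn (Suc n))"
      using ge2(2) by (simp add: algebra_simps)
    also note ge2(1)
    finally show ?case
      by (simp add: add_ac right_diff_distrib mult.assoc front_simps)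
  qed
  then show ?thesis by (simp add: algebra_simps)
qed

lemma zvar_mult_far':
  "zvar (p + int n + 2) * zvar p =
     zvar (p + int n + 1) * zvar (p + 1) + qhalf 1 * (Sn n * Ymon p (p - 1))"
proof -
  have "bar (zvar p * zvar (p + int n + 2)) =
      bar (zvar (p + 1) * zvar (p + int n + 1) + qhalf (-1) * (Ymon p (p - 1) * Sn n))"
    by (simp only: zvar_mult_far)
  then show ?thesis
    by (simp add: bar_mult bar_add bar_zvar bar_Sn qhalf_central[of "_ * _"])
qed

text \<open>As functions of \<open>n\<close>, \<open>S\<^sub>n\<^sub>+\<^sub>1 z\<^sub>m - H S\<^sub>n z\<^sub>m\<^sub>-\<^sub>1\<close> and \<open>z\<^sub>m\<^sub>+\<^sub>n\<^sub>+\<^sub>1\<close> solve the same recursion.\<close>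

lemma Sn_zvar: "Sn (Suc n) * zvar m = zvar (m + int n + 1) + H * (Sn n * zvar (m - 1))"
proof -
  have "Sn (Suc n) * zvar m - H * (Sn n * zvar (m - 1)) = zvar (m + int n + 1)"
  proof (induction n rule: induct_nat_012)
    case 0
    show ?case using X_delta_zvar[of m] by simp
  next
    case 1
    have "zvar (m + 2) = X_delta * (X_delta * zvar m - H * zvar (m - 1)) - H * zvar m"
      using X_delta_zvar[of m] zvar_next[of m] by simp
    then show ?case
      by (simp add: algebra_simps front_simps)
  next
    case (ge2 n)
    have "Sn (Suc (Suc (Suc n))) * zvar m - H * (Sn (Suc (Suc n)) * zvar (m - 1)) =
      X_delta * (Sn (Suc (Suc n)) * zvar m - H * (Sn (Suc n) * zvar (m - 1)))
      - H * (Sn (Suc n) * zvar m - H * (Sn n * zvar (m - 1)))"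
      unfolding Sn_Suc_Suc by (simp add: algebra_simps front_simps)
    also have "\<dots> = zvar (m + int n + 3)"
      unfolding ge2 using zvar_next[of "m + int n + 1"] by (simp add: algebra_simps)
    finally show ?case by (simp add: algebra_simps)
  qed
  then show ?thesis by (simp add: algebra_simps)
qed

lemma zvar_Sn:
  "zvar m * Sn (Suc n) = zvar (m + int n + 1) + qhalf (-2) * (H * (zvar (m - 1) * Sn n))"
proof -
  have "bar (Sn (Suc n) * zvar m) = bar (zvar (m + int n + 1) + H * (Sn n * zvar (m - 1)))"
    by (simp only: Sn_zvar)
  then have "zvar m * Sn (Suc n) = zvar (m + int n + 1) + zvar (m - 1) * (Sn n * H)"
    by (simp only: bar_mult bar_add bar_zvar bar_Sn bar_Xmon mult.assoc)
  also have "zvar (m - 1) * (Sn n * H) = qhalf (-2) * (H * (zvar (m - 1) * Sn n))"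
    using arg_cong[OF zvar_H[of "m - 1"], of "\<lambda>p. p * Sn n"] by (simp add: H_Sn mult.assoc)
  finally show ?thesis .
qed


section \<open>Positivity\<close>

text \<open>The nonnegative combinations of \<open>G\<close>: coefficients are built from monomials
  \<open>q\<^sup>r\<^sup>/\<^sup>2 X\<^sup>(\<^sup>0\<^sup>,\<^sup>0\<^sup>,\<^sup>c\<^sup>,\<^sup>d\<^sup>)\<close>, which are units, so rescaling a generator by one of them does not change the cone.\<close>

inductive_set cone :: "qtorus set \<Rightarrow> qtorus set" for G where
  zero: "0 \<in> cone G"
| add: "g \<in> G \<Longrightarrow> p \<in> cone G \<Longrightarrow> qhalf r * (Ymon c d * g) + p \<in> cone G"

lemma cone_unit_gen: "g \<in> G \<Longrightarrow> qhalf r * (Ymon c d * g) \<in> cone G"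
  using cone.add[OF _ cone.zero] by fastforce

lemma cone_gen: "g \<in> G \<Longrightarrow> g \<in> cone G"
  using cone_unit_gen[of g G 0 0 0] by (simp add: torus_simps)

lemma cone_add: "p \<in> cone G \<Longrightarrow> s \<in> cone G \<Longrightarrow> p + s \<in> cone G"
  by (induction p rule: cone.induct) (auto simp: add.assoc intro: cone.add)

lemma cone_unit: "p \<in> cone G \<Longrightarrow> qhalf r * (Ymon c d * p) \<in> cone G"
proof (induction p rule: cone.induct)
  case (add g p r' c' d')
  then show ?case
    using cone.add[OF add(1,3)] by (simp add: distrib_left torus_simps)
qed (simp add: cone.zero)

lemma cone_Ymon: "p \<in> cone G \<Longrightarrow> Ymon c d * p \<in> cone G"
  using cone_unit[of p G 0] by (simp add: qhalf_0)

lemma cone_subset: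
  assumes "\<And>g. g \<in> G \<Longrightarrow> g \<in> cone G'"
  shows "cone G \<subseteq> cone G'"
proof
  fix p assume "p \<in> cone G"
  then show "p \<in> cone G'"
    by induction (auto intro: cone.zero cone_add cone_unit assms)
qed

lemma cone_mult_right:
  assumes "p \<in> cone G" "\<And>g. g \<in> G \<Longrightarrow> g * x \<in> cone G'"
  shows "p * x \<in> cone G'"
  using assms(1)
  by induction (auto simp: distrib_right mult.assoc intro: cone.zero cone_add cone_unit assms(2))

lemma cone_mult_left:
  assumes "homogeneous \<alpha> \<beta> x" "p \<in> cone G" "\<And>g. g \<in> G \<Longrightarrow> x * g \<in> cone G'"
  shows "x * p \<in> cone G'"
  using assms(2)
proof induction
  case (add g p r c d)
  have "x * (qhalf r * (Ymon c d * g)) = qhalf r * (x * Ymon c d * g)"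
    by (simp add: qhalf_central_assoc[of x] mult.assoc)
  also have "\<dots> = qhalf (r - 2 * (c * \<alpha> + d * \<beta>)) * (Ymon c d * (x * g))"
    by (simp add: homogeneous_swap[OF assms(1)] torus_simps algebra_simps)
  finally show ?case
    using add by (auto simp: distrib_left intro: cone_add cone_unit assms(3))
qed (simp add: cone.zero)

text \<open>The cluster monomials and the \<open>S\<^sub>n\<close>, up to units in the coefficients; in this form the multiplication
  rules are uniform in \<open>m\<close>.\<close>

definition zmono :: "int \<Rightarrow> nat \<Rightarrow> nat \<Rightarrow> qtorus" where
  "zmono m a b = zvar m ^ a * zvar (m + 1) ^ b"

definition zstandard :: "qtorus set" where
  "zstandard = {zmono m a b | m a b. True} \<union> range Sn"

lemma zmono_in: "zmono m a b \<in> zstandard"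
  by (auto simp: zstandard_def)

lemma Sn_in: "Sn n \<in> zstandard"
  by (auto simp: zstandard_def)

lemma zmono_Suc_left: "zmono m (Suc a) b = zmono m a b * zvar m"
proof -
  have "zvar (m + 1) ^ b * zvar m = zvar m * zvar (m + 1) ^ b"
    by (intro power_commuting_commutes) (simp add: zvar_commute)
  then show ?thesis
    by (simp add: zmono_def power_Suc2 mult.assoc del: power_Suc)
qed

lemma zmono_Suc_right: "zmono m a (Suc b) = zmono m a b * zvar (m + 1)"
  by (simp add: zmono_def power_Suc2 mult.assoc del: power_Suc)

lemma zmono_shift: "zmono m 0 b = zmono (m + 1) b 0"
  by (simp add: zmono_def)

lemma zmono_0: "zmono m 0 0 = 1"
  by (simp add: zmono_def)

lemma homogeneous_zmono: "\<exists>\<alpha> \<beta>. homogeneous \<alpha> \<beta> (zmono m a b)"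
proof (induction a)
  case 0
  show ?case
  proof (induction b)
    case 0
    show ?case using homogeneous_one by (auto simp: zmono_0)
  next
    case (Suc b)
    then show ?case unfolding zmono_Suc_right by (meson homogeneous_mult homogeneous_zvar)
  qed
next
  case (Suc a)
  then show ?case unfolding zmono_Suc_left by (meson homogeneous_mult homogeneous_zvar)
qed

lemma Sn_zvar_cone: "Sn n * zvar m \<in> cone (range zvar)"
proof (induction n arbitrary: m)
  case (Suc n)
  show ?case unfolding Sn_zvar by (intro cone_add cone_Ymon Suc cone_gen) auto
qed (auto intro: cone_gen)

lemma zvar_Sn_cone: "zvar m * Sn n \<in> cone (range zvar)"
proof (induction n arbitrary: m)
  case (Suc n)
  show ?case unfolding zvar_Sn by (intro cone_add cone_unit Suc cone_gen) auto
qed (auto intro: cone_gen)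

lemma Sn_Sn_cone: "Sn m * Sn n \<in> cone (range Sn)"
proof (induction n arbitrary: m)
  case 0
  then show ?case by (auto intro: cone_gen)
next
  case (Suc n)
  show ?case
  proof (cases m)
    case 0
    then show ?thesis by (auto intro: cone_gen simp del: Sn.simps(3))
  next
    case (Suc k)
    show ?thesis unfolding Suc Sn_mult_Sn by (intro cone_add cone_Ymon Suc.IH cone_gen rangeI)
  qed
qed

text \<open>A factor \<open>z\<^sub>m\<close> absorbs \<open>S\<^sub>n\<close>, becoming a combination of variables.  This reduces the degree of the
  remaining monomial, so the claim can serve inside an induction on the degree: only products of
  smaller monomials with a variable are presupposed.\<close>

lemma zmono_mult_Sn:
  assumes "\<And>m' a' b' p. a' + b' < a + b \<Longrightarrow> zmono m' a' b' * zvar p \<in> cone zstandard"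
  shows "zmono m a b * Sn n \<in> cone zstandard"
proof -
  consider "a = 0" "b = 0" | a' where "a = Suc a'" | b' where "b = Suc b'"
    by (cases a; cases b) auto
  then show ?thesis
  proof cases
    case 1
    then show ?thesis by (auto simp: zmono_0 intro: cone_gen Sn_in)
  next
    case 2
    obtain \<alpha> \<beta> where h: "homogeneous \<alpha> \<beta> (zmono m a' b)"
      using homogeneous_zmono by blast
    show ?thesis
      unfolding 2 zmono_Suc_left mult.assoc
      by (rule cone_mult_left[OF h zvar_Sn_cone]) (use assms 2 in auto)
  next
    case 3
    obtain \<alpha> \<beta> where h: "homogeneous \<alpha> \<beta> (zmono m a b')"
      using homogeneous_zmono by blast
    show ?thesis
      unfolding 3 zmono_Suc_right mult.assoc
      by (rule cone_mult_left[OF h zvar_Sn_cone]) (use assms 3 in auto)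
  qed
qed

text \<open>Straightening, by induction on the degree and then on the distance of \<open>z\<^sub>p\<close> from the monomial.  If \<open>z\<^sub>p\<close>
  is not adjacent to the monomial, \<open>zvar_mult_far\<close> for \<open>z\<^sub>p\<close> and the variable of the monomial farther
  from it replaces the pair by a closer one, one member of which belongs to the cluster of the
  monomial; the remaining term is an \<open>S\<^sub>n\<close> times a monomial of smaller degree.\<close>

lemma zmono_mult_zvar: "zmono m a b * zvar p \<in> cone zstandard"
proof (induction "a + b" arbitrary: m a b p rule: less_induct)
  case less
  have lower: "zmono m a' b' * (qhalf r * (Ymon c d * Sn n)) \<in> cone zstandard"
    if "a' + b' < a + b" for m a' b' n r c d
  proof -
    obtain \<alpha> \<beta> where h: "homogeneous \<alpha> \<beta> (zmono m a' b')"
      using homogeneous_zmono by blast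
    show ?thesis
      by (rule cone_mult_left[OF h cone_unit_gen[of _ "{Sn n}"]])
        (use that less in \<open>auto intro!: zmono_mult_Sn\<close>)
  qed
  have up: "zmono m a' b' * zvar (m + int j) \<in> cone zstandard" if "a' + b' = a + b" for m a' b' j
    using that
  proof (induction j arbitrary: m a' b' rule: less_induct)
    case (less j)
    consider "j = 0" | "j = 1" | k where "j = Suc (Suc k)"
      by (metis One_nat_def nat.exhaust)
    then show ?case
    proof cases
      case 1
      then show ?thesis by (auto simp flip: zmono_Suc_left intro: cone_gen zmono_in)
    next
      case 2
      then show ?thesis by (auto simp flip: zmono_Suc_right intro: cone_gen zmono_in)
    next
      case 3
      show ?thesis
      proof (cases a')
        case 0
        have "zmono (m + 1) b' 0 * zvar (m + 1 + int (Suc k)) \<in> cone zstandard"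
          by (rule less.IH) (use 3 0 less.prems in auto)
        then show ?thesis by (simp add: 0 3 zmono_shift add_ac)
      next
        case (Suc a'')
        have "zmono m a' b' * zvar (m + int j) = zmono m a'' b' * (zvar m * zvar (m + int k + 2))"
          by (simp add: Suc 3 zmono_Suc_left mult.assoc add_ac)
        also have "\<dots> = zmono m a'' (Suc b') * zvar (m + int (Suc k)) +
            zmono m a'' b' * (qhalf (-1) * (Ymon m (m - 1) * Sn k))"
          unfolding zvar_mult_far by (simp add: zmono_Suc_right algebra_simps)
        also have "\<dots> \<in> cone zstandard"
          by (intro cone_add lower less.IH) (use 3 Suc less.prems in auto)
        finally show ?thesis .
      qed
    qed
  qed
  have down: "zmono m a' b' * zvar (m + 1 - int j) \<in> cone zstandard"
    if "a' + b' = a + b" for m a' b' j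
    using that
  proof (induction j arbitrary: m a' b' rule: less_induct)
    case (less j)
    consider "j = 0" | "j = 1" | k where "j = Suc (Suc k)"
      by (metis One_nat_def nat.exhaust)
    then show ?case
    proof cases
      case 1
      then show ?thesis by (auto simp flip: zmono_Suc_right intro: cone_gen zmono_in)
    next
      case 2
      then show ?thesis by (auto simp flip: zmono_Suc_left intro: cone_gen zmono_in)
    next
      case 3
      show ?thesis
      proof (cases b')
        case 0
        have "zmono (m - 1) 0 a' * zvar (m - 1 + 1 - int (Suc k)) \<in> cone zstandard"
          by (rule less.IH) (use 3 0 less.prems in auto)
        then show ?thesis by (simp add: 0 3 zmono_shift algebra_simps)
      next
        case (Suc b'')
        define q where "q = m - 1 - int k"
        have q: "q + int k + 2 = m + 1" "q + int k + 1 = m" "q + 1 = m + 1 - int (Suc k)"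
          "m + 1 - int j = q"
          by (auto simp: q_def 3)
        have "zmono m a' b' * zvar (m + 1 - int j) = zmono m a' b'' * (zvar (m + 1) * zvar q)"
          by (simp add: Suc q(4) zmono_Suc_right mult.assoc)
        also have "zvar (m + 1) * zvar q = zvar m * zvar (q + 1) + qhalf 1 * (Sn k * Ymon q (q - 1))"
          using zvar_mult_far'[of q k] unfolding q(1,2) .
        (* S_k is homogeneous of degree (-k, k), so the exchange costs the power q^k. *)
        also have "qhalf 1 * (Sn k * Ymon q (q - 1)) = qhalf (1 + 2 * int k) * (Ymon q (q - 1) * Sn k)"
          using homogeneous_swap[OF homogeneous_Sn[of k], of q "q - 1"]
          by (simp add: torus_simps algebra_simps)
        also have "zmono m a' b'' * (zvar m * zvar (q + 1) + qhalf (1 + 2 * int k) * (Ymon q (q - 1) * Sn k)) =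
            zmono m (Suc a') b'' * zvar (m + 1 - int (Suc k)) +
            zmono m a' b'' * (qhalf (1 + 2 * int k) * (Ymon q (q - 1) * Sn k))"
          by (simp add: q(3) zmono_Suc_left distrib_left mult.assoc)
        also have "\<dots> \<in> cone zstandard"
          by (intro cone_add lower less.IH) (use 3 Suc less.prems in auto)
        finally show ?thesis .
      qed
    qed
  qed
  show ?case
  proof (cases "p \<ge> m")
    case True
    then show ?thesis using up[OF refl, of m "nat (p - m)"] by simp
  next
    case False
    then show ?thesis using down[OF refl, of m "nat (m + 1 - p)"] by simp
  qed
qed

lemma zstandard_mult_zvar:
  assumes "g \<in> zstandard"
  shows "g * zvar p \<in> cone zstandard"
proof -
  have "range zvar \<subseteq> zstandard"
    using zmono_in[of _ 1 0] by (force simp: zmono_def)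
  then have "cone (range zvar) \<subseteq> cone zstandard"
    by (intro cone_subset cone_gen) auto
  then show ?thesis
    using assms zmono_mult_zvar Sn_zvar_cone by (auto simp: zstandard_def)
qed

lemma zstandard_mult_Sn:
  assumes "g \<in> zstandard"
  shows "g * Sn n \<in> cone zstandard"
proof -
  have "cone (range Sn) \<subseteq> cone zstandard"
    by (intro cone_subset cone_gen) (auto intro: Sn_in)
  then show ?thesis
    using assms zmono_mult_Sn[OF zmono_mult_zvar] Sn_Sn_cone by (auto simp: zstandard_def)
qed

lemma zstandard_mult:
  assumes "g \<in> zstandard" "t \<in> zstandard"
  shows "g * t \<in> cone zstandard"
proof -
  have "g * zmono m a b \<in> cone zstandard" for m a b
  proof (induction b)
    case 0
    show ?case
    proof (induction a)
      case 0
      then show ?case by (simp add: zmono_0 cone_gen assms)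
    next
      case (Suc a)
      then show ?case
        by (simp add: zmono_Suc_left cone_mult_right zstandard_mult_zvar flip: mult.assoc)
    qed
  next
    case (Suc b)
    then show ?case
      by (simp add: zmono_Suc_right cone_mult_right zstandard_mult_zvar flip: mult.assoc)
  qed
  moreover have "t \<in> {zmono m a b | m a b. True} \<or> t \<in> range Sn"
    using assms(2) by (simp add: zstandard_def)
  ultimately show ?thesis
    using zstandard_mult_Sn[OF assms(1)] by blast
qed

text \<open>The cluster variables themselves.  The factor \<open>q\<^sup>1\<^sup>/\<^sup>2\<close> makes the rescaled element bar-invariant.\<close>

definition cvar :: "int \<Rightarrow> qtorus" where
  "cvar m = (if m \<ge> 1 then zvar m else qhalf 1 * (Ymon (- m) (1 - m) * zvar m))"

definition cmono :: "int \<Rightarrow> nat \<Rightarrow> nat \<Rightarrow> qtorus" where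
  "cmono m a b = cvar m ^ a * cvar (m + 1) ^ b"

definition standard :: "qtorus set" where
  "standard = {cmono m a b | m a b. True} \<union> range Sn"

definition unit_multiple :: "qtorus \<Rightarrow> qtorus \<Rightarrow> bool" where
  "unit_multiple p s \<longleftrightarrow> (\<exists>r c d. p = qhalf r * (Ymon c d * s))"

lemma unit_multiple_refl: "unit_multiple p p"
  unfolding unit_multiple_def
  by (intro exI[of _ 0]) (simp add: torus_simps)

lemma unit_multiple_sym:
  assumes "unit_multiple p s"
  shows "unit_multiple s p"
proof -
  obtain r c d where "p = qhalf r * (Ymon c d * s)"
    using assms by (auto simp: unit_multiple_def)
  then have "s = qhalf (- r) * (Ymon (- c) (- d) * p)"
    by (simp add: torus_simps)
  then show ?thesis unfolding unit_multiple_def by blast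
qed

lemma unit_multiple_mult:
  assumes "unit_multiple p s" "unit_multiple p' s'" "homogeneous \<alpha> \<beta> s"
  shows "unit_multiple (p * p') (s * s')"
proof -
  obtain r c d where 1: "p = qhalf r * (Ymon c d * s)"
    using assms by (auto simp: unit_multiple_def)
  obtain r' c' d' where 2: "p' = qhalf r' * (Ymon c' d' * s')"
    using assms by (auto simp: unit_multiple_def)
  have "s * (Ymon c' d' * s') = qhalf (- 2 * (c' * \<alpha> + d' * \<beta>)) * (Ymon c' d' * (s * s'))"
    using homogeneous_swap[OF assms(3), of c' d'] by (simp flip: mult.assoc)
  then have "p * p' = qhalf (r + r' - 2 * (c' * \<alpha> + d' * \<beta>) + 2 * (d * c' - c * d')) *
      (Ymon (c + c') (d + d') * (s * s'))"
    unfolding 1 2 by (simp add: qhalf_central_assoc[of s] torus_simps algebra_simps)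
  then show ?thesis unfolding unit_multiple_def by blast
qed

lemma unit_multiple_cvar: "unit_multiple (cvar m) (zvar m)"
  using unit_multiple_refl by (auto simp: cvar_def unit_multiple_def)

lemma unit_multiple_cmono: "unit_multiple (cmono m a b) (zmono m a b)"
proof -
  have "unit_multiple (cvar m ^ a) (zvar m ^ a)" for m a
  proof (induction a)
    case (Suc a)
    then show ?case
      using unit_multiple_mult[OF unit_multiple_cvar Suc homogeneous_zvar] by simp
  qed (simp add: unit_multiple_refl)
  moreover obtain \<alpha> \<beta> where "homogeneous \<alpha> \<beta> (zvar m ^ a)"
    using homogeneous_zmono[of m a 0] by (auto simp: zmono_def)
  ultimately show ?thesis
    unfolding cmono_def zmono_def by (blast intro: unit_multiple_mult)
qed

lemma cone_standard: "cone standard = cone zstandard"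
proof
  have "cmono m a b \<in> cone zstandard" for m a b
    using unit_multiple_cmono[of m a b] cone_unit_gen[OF zmono_in]
    by (auto simp: unit_multiple_def)
  then show "cone standard \<subseteq> cone zstandard"
    by (intro cone_subset) (auto simp: standard_def intro: cone_gen Sn_in)
  have "zmono m a b \<in> cone standard" for m a b
  proof -
    have "cmono m a b \<in> standard" by (auto simp: standard_def)
    then show ?thesis
      using unit_multiple_sym[OF unit_multiple_cmono[of m a b]] cone_unit_gen
      by (auto simp: unit_multiple_def)
  qed
  then show "cone zstandard \<subseteq> cone standard"
    by (intro cone_subset) (auto simp: zstandard_def standard_def intro: cone_gen)
qed

lemma homogeneous_cmono: "\<exists>\<alpha> \<beta>. homogeneous \<alpha> \<beta> (cmono m a b)"
proof -
  obtain r c d where 1: "cmono m a b = qhalf r * (Ymon c d * zmono m a b)"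
    using unit_multiple_cmono[of m a b] by (auto simp: unit_multiple_def)
  then show ?thesis
    using homogeneous_zmono homogeneous_Xmon[of 0 d 0 c] homogeneous_qhalf[of r]
    by (metis homogeneous_mult)
qed

lemma homogeneous_standard: "s \<in> standard \<Longrightarrow> \<exists>\<alpha> \<beta>. homogeneous \<alpha> \<beta> s"
  unfolding standard_def using homogeneous_cmono homogeneous_Sn by blast

theorem standard_mult:
  assumes "s \<in> standard" "t \<in> standard"
  shows "s * t \<in> cone standard"
proof -
  have *: "\<exists>z\<in>zstandard. unit_multiple g z" if "g \<in> standard" for g
    using that unit_multiple_cmono unit_multiple_refl zmono_in Sn_in by (fastforce simp: standard_def)
  obtain z z' where z: "z \<in> zstandard" "unit_multiple s z" and z': "z' \<in> zstandard" "unit_multiple t z'"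
    using * assms by meson
  have "\<exists>\<alpha> \<beta>. homogeneous \<alpha> \<beta> z"
    using z(1) homogeneous_zmono homogeneous_Sn unfolding zstandard_def by blast
  then have "unit_multiple (s * t) (z * z')"
    using unit_multiple_mult[OF z(2) z'(2)] by blast
  then show ?thesis
    using zstandard_mult[OF z(1) z'(1)] by (auto simp: unit_multiple_def cone_standard cone_unit)
qed


section \<open>Pointed elements and linear independence\<close>

definition ydeg :: "qmon \<Rightarrow> int" where
  "ydeg m = coord (vexp m) 3 + coord (vexp m) 4"

text \<open>The elements whose monomials all have degree at least \<open>k\<close> in \<open>y\<^sub>1, y\<^sub>2\<close>.  This filtration of the
  torus is multiplicative, and its degree 0 part sees the leading terms.\<close>

definition yfilt :: "int \<Rightarrow> qtorus set" where
  "yfilt k = {p. \<forall>m\<in>Poly_Mapping.keys p. k \<le> ydeg m}"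

lemma vexp_add: "vexp (m + n) = vexp m + vexp n"
  by (simp add: plus_qmon_def)

lemma ydeg_add: "ydeg (m + n) = ydeg m + ydeg n"
  by (simp add: ydeg_def vexp_add coord_add)

lemma yfilt_zero: "0 \<in> yfilt k"
  by (simp add: yfilt_def)

lemma yfilt_add: "p \<in> yfilt k \<Longrightarrow> s \<in> yfilt k \<Longrightarrow> p + s \<in> yfilt k"
  using Poly_Mapping.keys_add[of p s] by (auto simp: yfilt_def)

lemma yfilt_uminus: "p \<in> yfilt k \<Longrightarrow> - p \<in> yfilt k"
  by (simp add: yfilt_def)

lemma yfilt_diff: "p \<in> yfilt k \<Longrightarrow> s \<in> yfilt k \<Longrightarrow> p - s \<in> yfilt k"
  using yfilt_add[OF _ yfilt_uminus] by fastforce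

lemma yfilt_sum: "(\<And>i. i \<in> I \<Longrightarrow> f i \<in> yfilt k) \<Longrightarrow> sum f I \<in> yfilt k"
  by (induction I rule: infinite_finite_induct) (auto intro: yfilt_zero yfilt_add)

lemma yfilt_mult: "p \<in> yfilt j \<Longrightarrow> s \<in> yfilt k \<Longrightarrow> p * s \<in> yfilt (j + k)"
  using keys_mult[of p s] by (fastforce simp: yfilt_def ydeg_add)

lemma yfilt_mono: "p \<in> yfilt j \<Longrightarrow> k \<le> j \<Longrightarrow> p \<in> yfilt k"
  by (force simp: yfilt_def)

lemma Xmon_yfilt: "k \<le> c + d \<Longrightarrow> Xmon (a, b, c, d) \<in> yfilt k"
  by (simp add: yfilt_def Xmon_def ydeg_def)

lemma qhalf_yfilt: "qhalf r \<in> yfilt 0"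
  by (simp add: yfilt_def qhalf_def ydeg_def zero_prod_def)

definition pointed :: "qtorus \<Rightarrow> int \<Rightarrow> int \<Rightarrow> bool" where
  "pointed p x y \<longleftrightarrow> p - Xmon (x, y, 0, 0) \<in> yfilt 1"

lemma pointed_yfilt: "pointed p x y \<Longrightarrow> p \<in> yfilt 0"
  using yfilt_add[OF yfilt_mono[of "p - Xmon (x, y, 0, 0)" 1 0] Xmon_yfilt[of 0 0 0 x y]]
  by (simp add: pointed_def)

lemma pointed_add: "pointed p x y \<Longrightarrow> s \<in> yfilt 1 \<Longrightarrow> pointed (p + s) x y"
  using yfilt_add[of "p - Xmon (x, y, 0, 0)" 1 s] by (simp add: pointed_def algebra_simps)

lemma pointed_diff: "pointed p x y \<Longrightarrow> s \<in> yfilt 1 \<Longrightarrow> pointed (p - s) x y"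
  using pointed_add[OF _ yfilt_uminus] by fastforce

lemma pointed_mult:
  assumes "pointed p x y" "pointed s x' y'"
  shows "pointed (p * s) (x + x') (y + y')"
proof -
  have "(p - Xmon (x, y, 0, 0)) * s + Xmon (x, y, 0, 0) * (s - Xmon (x', y', 0, 0)) \<in> yfilt 1"
    using yfilt_mult[of _ 1 s 0] yfilt_mult[of "Xmon (x, y, 0, 0)" 0 _ 1] assms pointed_yfilt[OF assms(2)]
    by (intro yfilt_add) (auto simp: pointed_def Xmon_yfilt)
  moreover have "Xmon (x + x', y + y', 0, 0) = Xmon (x, y, 0, 0) * Xmon (x', y', 0, 0)"
    by (simp add: torus_simps)
  ultimately show ?thesis
    by (simp add: pointed_def algebra_simps)
qed

lemma pointed_Xmon: "pointed (Xmon (x, y, 0, 0)) x y"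
  by (simp add: pointed_def yfilt_zero)

lemma pointed_one: "pointed 1 0 0"
  using pointed_Xmon[of 0 0] by (simp add: Xmon_zero)

lemma pointed_power: "pointed p x y \<Longrightarrow> pointed (p ^ n) (int n * x) (int n * y)"
proof (induction n)
  case (Suc n)
  show ?case
    using pointed_mult[OF Suc.prems Suc.IH[OF Suc.prems]] by (simp add: algebra_simps)
qed (simp add: pointed_one)

lemma pointed_unique:
  assumes "pointed p x y" "pointed p x' y'"
  shows "x = x' \<and> y = y'"
proof (rule ccontr)
  assume ne: "\<not> (x = x' \<and> y = y')"
  have "Xmon (x, y, 0, 0) - Xmon (x', y', 0, 0) \<in> yfilt 1"
    using yfilt_diff[of "p - Xmon (x', y', 0, 0)" 1 "p - Xmon (x, y, 0, 0)"] assms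
    by (simp add: pointed_def)
  moreover have "QMon 0 (x, y, 0, 0) \<in> Poly_Mapping.keys (Xmon (x, y, 0, 0) - Xmon (x', y', 0, 0))"
    using ne by (auto simp: in_keys_iff lookup_minus Xmon_def lookup_single when_def)
  ultimately show False by (auto simp: yfilt_def ydeg_def)
qed

text \<open>The \<open>g\<close>-vector of \<open>x\<^sub>m\<close> is both its leading exponent at \<open>y\<^sub>1 = y\<^sub>2 = 0\<close> (\<open>pointed_cvar\<close>) and its degree
  as a homogeneous element (\<open>homogeneous_cvar\<close>).\<close>

definition gvec1 :: "int \<Rightarrow> int" where
  "gvec1 m = (if m \<ge> 1 then 2 - m else m)"

definition gvec2 :: "int \<Rightarrow> int" where
  "gvec2 m = (if m \<ge> 1 then m - 1 else - m - 1)"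

lemma cvar_0: "cvar 0 = Xmon (0, -1, 0, 0) + Xmon (2, -1, 0, 1)"
  by (simp add: cvar_def zvar_0 algebra_simps torus_simps)

lemma cvar_up: "m \<ge> 1 \<Longrightarrow> cvar (m + 2) = X_delta * cvar (m + 1) - H * cvar m"
  by (simp add: cvar_def zvar_next)

text \<open>Passing from \<open>z\<^sub>m\<close> to \<open>x\<^sub>m\<close> breaks the uniform recursion only at \<open>m = 0, 1\<close>.  For negative \<open>m\<close> it reverses
  direction (\<open>cvar_down\<close>), so that, going away from the initial cluster, the next variable is always \<open>X\<^sub>\<delta>\<close>
  times the preceding one up to terms of positive degree in \<open>y\<^sub>1, y\<^sub>2\<close>.\<close>

lemma cvar_minus_1: "cvar (- 1) = X_delta * cvar 0 - qhalf (-1) * (Ymon 0 1 * cvar 1)"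
proof -
  have "Ymon 0 1 * X_delta = qhalf 2 * (X_delta * Ymon 0 1)"
    using homogeneous_X_delta by (simp add: homogeneous_def)
  from arg_cong[OF this, of "\<lambda>p. p * zvar 0"]
  have "Ymon 0 1 * (X_delta * zvar 0) = qhalf 2 * (X_delta * (Ymon 0 1 * zvar 0))"
    by (simp add: mult.assoc)
  then have "X_delta * cvar 0 = qhalf (-1) * (Ymon 0 1 * (X_delta * zvar 0))"
    by (simp add: cvar_def front_simps torus_simps)
  then show ?thesis
    using X_delta_zvar[of 0] by (simp add: cvar_def algebra_simps torus_simps)
qed

lemma cvar_down:
  assumes "m \<le> - 1"
  shows "cvar (m - 1) = X_delta * cvar m - H * cvar (m + 1)"
proof -
  have "Ymon (- m) (1 - m) * X_delta = qhalf 2 * (X_delta * Ymon (- m) (1 - m))"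
    using homogeneous_X_delta by (simp add: homogeneous_def)
  from arg_cong[OF this, of "\<lambda>p. p * zvar m"]
  have "Ymon (- m) (1 - m) * (X_delta * zvar m) =
      qhalf 2 * (X_delta * (Ymon (- m) (1 - m) * zvar m))"
    by (simp add: mult.assoc)
  then have "X_delta * cvar m = qhalf (-1) * (Ymon (- m) (1 - m) * (X_delta * zvar m))"
    using assms by (simp add: cvar_def front_simps torus_simps)
  then show ?thesis
    using assms by (simp add: cvar_def X_delta_zvar algebra_simps torus_simps)
qed

lemma pointed_X_delta: "pointed X_delta (-1) 1"
proof -
  have "pointed (Xmon (-1, 1, 0, 0) + (Xmon (1, -1, 1, 1) + Xmon (-1, -1, 1, 0))) (-1) 1"
    by (intro pointed_add pointed_Xmon yfilt_add Xmon_yfilt) auto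
  then show ?thesis by (simp add: X_delta_def add_ac)
qed

lemma H_yfilt:
  assumes "p \<in> yfilt 0"
  shows "H * p \<in> yfilt 1"
proof -
  have "H \<in> yfilt 1" by (simp add: Xmon_yfilt)
  from yfilt_mult[OF this assms] show ?thesis by simp
qed

lemma pointed_Sn: "pointed (Sn n) (- int n) (int n)"
proof (induction n rule: induct_nat_012)
  case (ge2 n)
  have "pointed (X_delta * Sn (Suc n) - H * Sn n) (- 1 + - int (Suc n)) (1 + int (Suc n))"
    by (intro pointed_diff pointed_mult pointed_X_delta ge2 H_yfilt pointed_yfilt[OF ge2(1)])
  then show ?case unfolding Sn_Suc_Suc by simp
qed (simp_all add: pointed_one pointed_X_delta)

lemma pointed_cvar: "pointed (cvar m) (gvec1 m) (gvec2 m)"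
proof -
  have up: "pointed (cvar (int n + 1)) (1 - int n) (int n)" for n
  proof (induction n rule: induct_nat_012)
    case 0
    then show ?case using pointed_Xmon[of 1 0] by (simp add: cvar_def zvar_1)
  next
    case 1
    then show ?case using pointed_Xmon[of 0 1] by (simp add: cvar_def zvar_2)
  next
    case (ge2 n)
    have "pointed (X_delta * cvar (int n + 1 + 1) - H * cvar (int n + 1))
        (- 1 + (1 - int (Suc n))) (1 + int (Suc n))"
      using ge2(2)
      by (intro pointed_diff pointed_mult pointed_X_delta H_yfilt pointed_yfilt[OF ge2(1)])
        (simp add: add_ac)
    moreover have "cvar (int (Suc (Suc n)) + 1) = X_delta * cvar (int n + 1 + 1) - H * cvar (int n + 1)"
      using cvar_up[of "int n + 1"] by (simp add: add_ac)
    ultimately show ?case by (simp add: add_ac)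
  qed
  have down: "pointed (cvar (- int n)) (- int n) (int n - 1)" for n
  proof (induction n rule: induct_nat_012)
    case 0
    have "pointed (Xmon (0, -1, 0, 0) + Xmon (2, -1, 0, 1)) 0 (-1)"
      by (intro pointed_add pointed_Xmon Xmon_yfilt) auto
    then show ?case by (simp add: cvar_0)
  next
    case 1
    have "pointed (cvar 0) 0 (-1)"
      using pointed_add[OF pointed_Xmon Xmon_yfilt[of 1 0 1 2 "-1"], of 0 "-1"]
      by (simp add: cvar_0)
    moreover have "cvar 1 \<in> yfilt 0"
      using up[of 0] by (simp add: pointed_yfilt)
    then have "Ymon 0 1 * cvar 1 \<in> yfilt 1"
      using yfilt_mult[OF Xmon_yfilt[of 1 0 1 0 0]] by force
    then have "qhalf (-1) * (Ymon 0 1 * cvar 1) \<in> yfilt 1"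
      using yfilt_mult[OF qhalf_yfilt] by force
    ultimately have "pointed (X_delta * cvar 0 - qhalf (-1) * (Ymon 0 1 * cvar 1)) (-1 + 0) (1 + - 1)"
      by (intro pointed_diff pointed_mult pointed_X_delta)
    then show ?case by (simp add: cvar_minus_1)
  next
    case (ge2 n)
    have "pointed (X_delta * cvar (- int (Suc n)) - H * cvar (- int n))
        (- 1 + - int (Suc n)) (1 + (int (Suc n) - 1))"
      using ge2(2)
      by (intro pointed_diff pointed_mult pointed_X_delta H_yfilt pointed_yfilt[OF ge2(1)])
    moreover have "cvar (- int (Suc (Suc n))) = X_delta * cvar (- int (Suc n)) - H * cvar (- int n)"
      using cvar_down[of "- int (Suc n)"] by (simp add: add_ac)
    ultimately show ?case by (simp add: add_ac)
  qed
  show ?thesis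
    using up[of "nat (m - 1)"] down[of "nat (- m)"] by (auto simp: gvec1_def gvec2_def)
qed

lemma pointed_cmono:
  "pointed (cmono m a b) (int a * gvec1 m + int b * gvec1 (m + 1)) (int a * gvec2 m + int b * gvec2 (m + 1))"
  unfolding cmono_def by (intro pointed_mult pointed_power pointed_cvar)

text \<open>The basis element with \<open>g\<close>-vector \<open>(x, y)\<close>.  The \<open>g\<close>-vectors \<open>(2 - m, m - 1)\<close>, \<open>m \<ge> 1\<close>, lie on the line
  \<open>x + y = 1\<close>, and \<open>(m, -m - 1)\<close>, \<open>m \<le> 0\<close>, on the line \<open>x + y = -1\<close>.  Hence a monomial in a
  cluster \<open>{x\<^sub>m, x\<^sub>m\<^sub>+\<^sub>1}\<close> with \<open>m \<noteq> 0\<close> has degree \<open>\<bar>x + y\<bar>\<close>, and division with remainder by it recovers \<open>m\<close>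
  and the exponents; the cluster \<open>{x\<^sub>0, x\<^sub>1}\<close> covers the fourth quadrant, and the ray through \<open>(-1, 1)\<close> that all these cones omit
  belongs to the \<open>S\<^sub>n\<close>.\<close>

definition standard_of :: "int \<Rightarrow> int \<Rightarrow> qtorus" where
  "standard_of x y =
     (if x + y > 0 \<and> y \<ge> 0 then
        cmono (y div (x + y) + 1) (nat (x + y - y mod (x + y))) (nat (y mod (x + y)))
      else if x + y < 0 \<and> x < 0 then
        cmono (x div (- x - y)) (nat (- x - y - x mod (- x - y))) (nat (x mod (- x - y)))
      else if x \<ge> 0 then cmono 0 (nat (- y)) (nat x)
      else Sn (nat y))"

lemma cmono_shift: "cmono m 0 b = cmono (m + 1) b 0"
  by (simp add: cmono_def)

lemma div_mod_split: "0 \<le> b \<Longrightarrow> b < d \<Longrightarrow> (d * m + b) div d = m \<and> (d * m + b) mod d = b"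
  for b d m :: int
  by (simp add: div_add1_eq)

lemma cmono_standard_of:
  "cmono m a b = standard_of (int a * gvec1 m + int b * gvec1 (m + 1)) (int a * gvec2 m + int b * gvec2 (m + 1))"
proof -
  have *: "cmono m a b = standard_of (int a * gvec1 m + int b * gvec1 (m + 1))
      (int a * gvec2 m + int b * gvec2 (m + 1))" if "a > 0" for m a b
  proof -
    define d where "d = int a + int b"
    have d: "0 \<le> int b" "int b < d" using that by (auto simp: d_def)
    let ?x = "int a * gvec1 m + int b * gvec1 (m + 1)" and ?y = "int a * gvec2 m + int b * gvec2 (m + 1)"
    consider "m \<ge> 1" | "m = 0" | "m \<le> - 1" by linarith
    then show "cmono m a b = standard_of ?x ?y"
    proof cases
      case 1
      have "?x + ?y = d" "?y = d * (m - 1) + int b"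
        using 1 by (simp_all add: gvec1_def gvec2_def d_def algebra_simps)
      moreover have "d * (m - 1) \<ge> 0" using 1 d by simp
      ultimately show ?thesis
        using d div_mod_split[of "int b" d "m - 1"]
        by (simp add: standard_of_def) (simp add: d_def)
    next
      case 2
      then show ?thesis using that by (simp add: standard_of_def gvec1_def gvec2_def)
    next
      case 3
      have "- ?x - ?y = d" "?x = d * m + int b"
        using 3 by (simp_all add: gvec1_def gvec2_def d_def algebra_simps)
      moreover have "d * m \<le> d * (- 1)" using 3 d by (intro mult_left_mono) auto
      ultimately show ?thesis
        using d div_mod_split[of "int b" d m]
        by (simp add: standard_of_def) (simp add: d_def)
    qed
  qed
  show ?thesis
  proof (cases "a = 0")
    case True
    show ?thesis
    proof (cases "b = 0")
      case True
      then show ?thesis using \<open>a = 0\<close> by (simp add: standard_of_def cmono_def)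
    next
      case False
      then show ?thesis using *[of b "m + 1" 0] \<open>a = 0\<close> by (simp add: cmono_shift)
    qed
  qed (use * in auto)
qed

lemma standard_pointed:
  assumes "s \<in> standard"
  obtains x y where "pointed s x y" "s = standard_of x y"
proof -
  have "Sn n = standard_of (- int n) (int n)" for n
    by (cases "n = 0") (auto simp: standard_of_def cmono_def simp del: Sn.simps(3))
  then show ?thesis
    using assms that pointed_cmono pointed_Sn cmono_standard_of unfolding standard_def by blast
qed

text \<open>The ray through \<open>(-1, 1)\<close> contains no nonzero \<open>g\<close>-vector of a cluster monomial.\<close>

lemma cmono_neq_Sn:
  assumes "n \<ge> 1"
  shows "cmono m a b \<noteq> Sn n"
proof
  assume "cmono m a b = Sn n"
  with pointed_unique[OF pointed_cmono[of m a b]] pointed_Sn[of n]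
  have "int a * gvec1 m + int b * gvec1 (m + 1) = - int n" "int a * gvec2 m + int b * gvec2 (m + 1) = int n"
    by auto
  note n = this
  consider "m \<ge> 1" | "m = 0" | "m \<le> - 1" by linarith
  then show False
  proof cases
    case 1
    with n have "int a + int b = 0" by (simp add: gvec1_def gvec2_def algebra_simps)
    then have "a = 0" "b = 0" by auto
    with n assms show ?thesis by simp
  next
    case 2
    with n assms show ?thesis by (simp add: gvec1_def)
  next
    case 3
    with n have "int a + int b = 0" by (simp add: gvec1_def gvec2_def algebra_simps)
    then have "a = 0" "b = 0" by auto
    with n assms show ?thesis by simp
  qed
qed

lemma lookup_mult_Xmon:
  "Poly_Mapping.lookup (p * Xmon e) (m + QMon 0 e) = Poly_Mapping.lookup p m"
proof (induction p rule: qtorus_induct)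
  case (single r f n)
  have "QMon r f + QMon 0 e = m + QMon 0 e \<longleftrightarrow> QMon r f = m"
    by (cases m) (auto simp: plus_qmon_def)
  then show ?case
    by (simp add: Xmon_def mult_single lookup_single)
qed (simp add: algebra_simps lookup_add)

text \<open>Let \<open>k\<close> be the least degree in \<open>y\<^sub>1, y\<^sub>2\<close> of a term of a coefficient.  In degree \<open>k\<close> the relation reads
  \<open>\<Sum> c\<^sub>u X\<^sup>g\<^sup>(\<^sup>u\<^sup>) = 0\<close>, and its terms do not interact because the \<open>g(u)\<close> are distinct and coefficients do not
  involve the first two coordinates.\<close>

theorem standard_independent:
  assumes "finite F" "F \<subseteq> standard" "\<And>s. s \<in> F \<Longrightarrow> c s \<in> coeff_ring"
    and sum0: "(\<Sum>s\<in>F. c s * s) = 0" and "s \<in> F"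
  shows "c s = 0"
proof (rule ccontr)
  assume "c s \<noteq> 0"
  define K where "K = (\<Union>s\<in>F. ydeg ` Poly_Mapping.keys (c s))"
  have "finite K" by (simp add: K_def assms(1))
  have "K \<noteq> {}" using \<open>c s \<noteq> 0\<close> \<open>s \<in> F\<close> by (auto simp: K_def)
  define k where "k = Min K"
  have "k \<in> K" using \<open>finite K\<close> \<open>K \<noteq> {}\<close> by (simp add: k_def)
  then obtain t m where t: "t \<in> F" "m \<in> Poly_Mapping.keys (c t)" "ydeg m = k"
    by (auto simp: K_def)
  have ck: "c u \<in> yfilt k" if "u \<in> F" for u
    using that \<open>finite K\<close> by (auto simp: yfilt_def k_def K_def intro!: Min_le)
  have "\<forall>u\<in>F. \<exists>x y. pointed u x y \<and> u = standard_of x y"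
    using assms(2) standard_pointed by (metis subsetD)
  then obtain x y where xy: "\<And>u. u \<in> F \<Longrightarrow> pointed u (x u) (y u) \<and> u = standard_of (x u) (y u)"
    by metis
  let ?X = "\<lambda>u. Xmon (x u, y u, 0, 0)" and ?m = "m + QMon 0 (x t, y t, 0, 0)"
  have "(\<Sum>u\<in>F. c u * ?X u) = - (\<Sum>u\<in>F. c u * (u - ?X u))"
    using sum0 by (simp add: right_diff_distrib sum_subtractf)
  also have "\<dots> \<in> yfilt (k + 1)"
    using xy ck by (intro yfilt_uminus yfilt_sum yfilt_mult) (auto simp: pointed_def)
  finally have "Poly_Mapping.lookup (\<Sum>u\<in>F. c u * ?X u) ?m = 0"
    using t(3) by (force simp: yfilt_def ydeg_add in_keys_iff ydeg_def[of "QMon _ _"])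
  moreover have "Poly_Mapping.lookup (c u * ?X u) ?m = 0" if "u \<in> F" "u \<noteq> t" for u
  proof (rule ccontr)
    assume "Poly_Mapping.lookup (c u * ?X u) ?m \<noteq> 0"
    then have "?m \<in> Poly_Mapping.keys (c u * ?X u)" by (simp add: in_keys_iff)
    then obtain n where n: "n \<in> Poly_Mapping.keys (c u)" "?m = n + QMon 0 (x u, y u, 0, 0)"
      using keys_mult[of "c u" "?X u"] by (auto simp: Xmon_def)
    have "coord (vexp ?m) i = coord (x t, y t, 0, 0) i" if "i = 1 \<or> i = 2" for i
      using assms(3)[OF t(1)] t(2) that by (auto simp: coeff_ring_def vexp_add coord_add)
    moreover have "coord (vexp ?m) i = coord (x u, y u, 0, 0) i" if "i = 1 \<or> i = 2" for i
      using assms(3)[OF \<open>u \<in> F\<close>] n that by (auto simp: coeff_ring_def vexp_add coord_add)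
    ultimately have "coord (x t, y t, 0, 0) i = coord (x u, y u, 0, 0) i" if "i = 1 \<or> i = 2" for i
      using that by metis
    from this[of 1] this[of 2] have "x t = x u" "y t = y u" by auto
    then show False using xy[OF t(1)] xy[OF that(1)] that(2) by metis
  qed
  then have "Poly_Mapping.lookup (\<Sum>u\<in>F. c u * ?X u) ?m = Poly_Mapping.lookup (c t * ?X t) ?m"
    using assms(1) t(1) by (simp add: lookup_sum lookup_add sum.remove[of F t])
  ultimately show False
    using t(2) by (simp add: lookup_mult_Xmon in_keys_iff)
qed


section \<open>Exchange relations of the cluster variables\<close>

lemma zvar_Ymon: "zvar m * Ymon c d = qhalf (- 2 * (c * (2 - m) + d * (m - 1))) * (Ymon c d * zvar m)"
  by (rule homogeneous_swap[OF homogeneous_zvar])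

lemma zvar_Ymon_assoc:
  "zvar m * (Ymon c d * p) = qhalf (- 2 * (c * (2 - m) + d * (m - 1))) * (Ymon c d * (zvar m * p))"
  using arg_cong[OF zvar_Ymon[of m c d], of "\<lambda>s. s * p"] by (simp only: mult.assoc)

lemmas zvar_simps = zvar_Ymon zvar_Ymon_assoc qhalf_central[of "zvar m" for m]
  qhalf_central_assoc[of "zvar m" for m] torus_simps

lemma homogeneous_cvar: "homogeneous (gvec1 m) (gvec2 m) (cvar m)"
proof (cases "m \<ge> 1")
  case True
  then show ?thesis using homogeneous_zvar[of m] by (simp add: cvar_def gvec1_def gvec2_def)
next
  case False
  have "homogeneous (0 + (0 - 2 * (1 - m) + (2 - m))) (0 + (0 + 2 * (- m) + (m - 1))) (cvar m)"
    using False by (simp only: cvar_def if_False)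
      (intro homogeneous_mult homogeneous_qhalf homogeneous_Xmon homogeneous_zvar)
  then show ?thesis using False by (simp add: gvec1_def gvec2_def)
qed

lemma bar_cvar: "bar (cvar m) = cvar m"
  by (simp add: cvar_def bar_mult bar_zvar zvar_simps algebra_simps)

lemma cvar_commute: "cvar m * cvar (m + 1) = cvar (m + 1) * cvar m"
proof -
  consider "m \<ge> 1" | "m = 0" | "m \<le> - 1" by linarith
  then show ?thesis
  proof cases
    case 1
    then show ?thesis by (simp add: cvar_def zvar_commute)
  next
    case 2
    then show ?thesis by (simp add: cvar_def zvar_0 zvar_1 torus_simps algebra_simps)
  next
    case 3
    have "zvar m * zvar (1 + m) = zvar (1 + m) * zvar m"
      using zvar_commute[of m] by (simp add: add.commute)
    with 3 show ?thesis
      by (simp add: cvar_def zvar_simps algebra_simps)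
  qed
qed

text \<open>The frozen part of the column of the exchange matrix that belongs to \<open>x\<^sub>n\<close> in the seed with cluster
  \<open>{x\<^sub>n, x\<^sub>n\<^sub>+\<^sub>1}\<close>.  The column of the other variable has the negative of the entries for \<open>n - 1\<close>, because
  mutation changes the sign of the column it acts on.\<close>

definition frozen1 :: "int \<Rightarrow> int" where
  "frozen1 n = (if n \<ge> 0 then n else - n - 2)"

definition frozen2 :: "int \<Rightarrow> int" where
  "frozen2 n = (if n \<ge> 0 then n - 1 else - n - 1)"

text \<open>The quantum exchange relation for the true cluster variables, in the shape that mutation produces:
  the frozen variables enter through the positive and negative parts of the frozen entries, and the
  powers of \<open>q\<close> are the normalizations of the two monomials.\<close>

lemma cvar_exchange:
  "cvar n * cvar (n + 2) =
     qhalf (- pos (- frozen1 n) * gvec1 n - pos (- frozen2 n) * gvec2 n +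
       2 * (pos (- frozen1 n) * gvec1 (n + 1) + pos (- frozen2 n) * gvec2 (n + 1))) *
       (cvar (n + 1) ^ 2 * Ymon (pos (- frozen1 n)) (pos (- frozen2 n))) +
     qhalf (- pos (frozen1 n) * gvec1 n - pos (frozen2 n) * gvec2 n) * Ymon (pos (frozen1 n)) (pos (frozen2 n))"
proof -
  (* The normalization of the three variables changes between n = -2 and n = 1. *)
  consider "n \<ge> 1" | "n = 0" | "n = - 1" | "n \<le> - 2" by linarith
  then show ?thesis
  proof cases
    case 1
    then show ?thesis
      using zvar_exchange[of n]
      by (simp add: cvar_def frozen1_def frozen2_def pos_def gvec1_def gvec2_def power2_eq_square torus_simps
          algebra_simps)
  next
    case 2
    then show ?thesis
      using zvar_exchange[of 0]
      by (simp add: cvar_def frozen1_def frozen2_def pos_def gvec1_def gvec2_def power2_eq_square zvar_simps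
          algebra_simps)
  next
    case 3
    then show ?thesis
      using zvar_exchange[of "- 1"]
      by (simp add: cvar_def frozen1_def frozen2_def pos_def gvec1_def gvec2_def power2_eq_square zvar_simps
          algebra_simps)
  next
    case 4
    (* Exponents that simplification leaves in two different normal forms. *)
    have e: "- (n * 2) - 2 = - 2 - n * 2" "- n - 1 = - 1 - n" by simp_all
    from 4 show ?thesis
      using zvar_exchange[of n]
      by (simp add: cvar_def frozen1_def frozen2_def pos_def gvec1_def gvec2_def power2_eq_square zvar_simps
          algebra_simps) (simp only: e)
  qed
qed

lemma cvar_exchange':
  "cvar (n + 2) * cvar n =
     qhalf (- pos (- frozen1 n) * gvec1 (n + 2) - pos (- frozen2 n) * gvec2 (n + 2) +
       2 * (pos (- frozen1 n) * gvec1 (n + 1) + pos (- frozen2 n) * gvec2 (n + 1))) *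
       (cvar (n + 1) ^ 2 * Ymon (pos (- frozen1 n)) (pos (- frozen2 n))) +
     qhalf (- pos (frozen1 n) * gvec1 (n + 2) - pos (frozen2 n) * gvec2 (n + 2)) *
       Ymon (pos (frozen1 n)) (pos (frozen2 n))"
proof -
  define e where "e = pos (- frozen1 n) * gvec1 n + pos (- frozen2 n) * gvec2 n"
  define f where "f = pos (- frozen1 n) * gvec1 (n + 1) + pos (- frozen2 n) * gvec2 (n + 1)"
  define e' where "e' = pos (frozen1 n) * gvec1 n + pos (frozen2 n) * gvec2 n"
  have h: "homogeneous (2 * gvec1 (n + 1)) (2 * gvec2 (n + 1)) (cvar (n + 1) ^ 2)"
    using homogeneous_mult[OF homogeneous_cvar[of "n + 1"] homogeneous_cvar[of "n + 1"]]
    by (simp add: power2_eq_square)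
  have "bar (cvar n * cvar (n + 2)) = bar (
     qhalf (- e + 2 * f) * (cvar (n + 1) ^ 2 * Ymon (pos (- frozen1 n)) (pos (- frozen2 n))) +
     qhalf (- e') * Ymon (pos (frozen1 n)) (pos (frozen2 n)))"
    using cvar_exchange[of n] by (simp add: e_def f_def e'_def)
  then have "cvar (n + 2) * cvar n =
     qhalf (e - 2 * f) * (Ymon (pos (- frozen1 n)) (pos (- frozen2 n)) * cvar (n + 1) ^ 2) +
     qhalf e' * Ymon (pos (frozen1 n)) (pos (frozen2 n))"
    by (simp add: bar_mult bar_add bar_cvar power2_eq_square qhalf_central[of "_ * _"]
        qhalf_central[of "Xmon u" for u])
  also have "Ymon (pos (- frozen1 n)) (pos (- frozen2 n)) * cvar (n + 1) ^ 2 =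
      qhalf (4 * f) * (cvar (n + 1) ^ 2 * Ymon (pos (- frozen1 n)) (pos (- frozen2 n)))"
    using h by (simp add: homogeneous_def f_def algebra_simps)
  moreover have "- pos (- frozen1 n) * gvec1 (n + 2) - pos (- frozen2 n) * gvec2 (n + 2) = e"
    "- pos (frozen1 n) * gvec1 (n + 2) - pos (frozen2 n) * gvec2 (n + 2) = e'"
  proof -
    consider "n \<ge> 1" | "n = 0" | "n = - 1" | "n \<le> - 2" by linarith
    then show "- pos (- frozen1 n) * gvec1 (n + 2) - pos (- frozen2 n) * gvec2 (n + 2) = e"
      "- pos (frozen1 n) * gvec1 (n + 2) - pos (frozen2 n) * gvec2 (n + 2) = e'"
      by (cases; simp add: e_def e'_def frozen1_def frozen2_def pos_def gvec1_def gvec2_def algebra_simps)+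
  qed
  ultimately show ?thesis
    by (simp only: qhalf_mult_assoc flip: f_def) (simp add: algebra_simps)
qed

lemma frozen1_rec: "frozen1 (n + 1) = 2 * pos (frozen1 n) - frozen1 (n - 1)"
  by (auto simp: frozen1_def pos_def max_def)

lemma frozen2_rec: "frozen2 (n + 1) = 2 * pos (frozen2 n) - frozen2 (n - 1)"
  by (auto simp: frozen2_def pos_def max_def)

lemma gvec1_rec: "gvec1 (n + 2) = 2 * gvec1 (n + 1) - gvec1 n - 2 * pos (- frozen2 n)"
  by (auto simp: gvec1_def frozen2_def pos_def max_def)

lemma gvec2_rec: "gvec2 (n + 2) = 2 * gvec2 (n + 1) - gvec2 n + 2 * pos (- frozen1 n)"
  by (auto simp: gvec2_def frozen1_def pos_def max_def)

lemma gvec1_rec': "gvec1 n = - gvec1 (n + 2) - 2 * pos (frozen2 n)"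
  by (auto simp: gvec1_def frozen2_def pos_def max_def)

lemma gvec2_rec': "gvec2 n = - gvec2 (n + 2) + 2 * pos (frozen1 n)"
  by (auto simp: gvec2_def frozen1_def pos_def max_def)


section \<open>The quantum seeds\<close>

lemma Ymon_power: "Ymon c d ^ n = Ymon (int n * c) (int n * d)"
proof (induction n)
  case (Suc n)
  then show ?case by (simp add: torus_simps algebra_simps)
qed (simp add: Xmon_zero)

lemma sum_pairs_4:
  "(\<Sum>i\<in>{1..4}. \<Sum>j\<in>{i<..4}. f i j) = f 1 2 + f 1 3 + f 1 4 + f 2 3 + f 2 4 + f 3 (4::nat)"
  for f :: "nat \<Rightarrow> nat \<Rightarrow> int"
proof -
  have "{1..4} = {1, 2, 3, 4::nat}" "{1<..4} = {2, 3, 4::nat}" "{2<..4} = {3, 4::nat}"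
    "{3<..4} = {4::nat}" by auto
  then show ?thesis by simp
qed

lemma atLeastAtMost_1_4: "{1..4} = {1, 2, 3, 4::nat}"
  by auto

lemma mutate_Lam_other:
  assumes "k = 1 \<and> l = 2 \<or> k = 2 \<and> l = 1" "r \<in> {l, 3, 4}" "r' \<in> {l, 3, 4}"
  shows "mutate_Lam L B k r r' = L r r'"
  unfolding mutate_Lam_def atLeastAtMost_1_4 using assms
  by (elim disjE conjE insertE emptyE) (simp_all add: mutation_E_def)

lemma mutate_Lam_right:
  assumes "k = 1 \<and> l = 2 \<or> k = 2 \<and> l = 1" "r \<in> {l, 3, 4}"
  shows "mutate_Lam L B k r k = - L r k + pos (- B l k) * L r l + pos (- B 3 k) * L r 3 +
    pos (- B 4 k) * L r 4"
  unfolding mutate_Lam_def atLeastAtMost_1_4 using assms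
  by (elim disjE conjE insertE emptyE) (simp_all add: mutation_E_def)

lemma mutate_Lam_left:
  assumes "k = 1 \<and> l = 2 \<or> k = 2 \<and> l = 1" "r \<in> {l, 3, 4}"
  shows "mutate_Lam L B k k r = - L k r + pos (- B l k) * L l r + pos (- B 3 k) * L 3 r +
    pos (- B 4 k) * L 4 r"
  unfolding mutate_Lam_def atLeastAtMost_1_4 using assms
  by (elim disjE conjE insertE emptyE) (simp_all add: mutation_E_def)

lemma mutate_Lam_diag:
  assumes "k = 1 \<and> l = 2 \<or> k = 2 \<and> l = 1"
  shows "mutate_Lam L B k k k =
    (let u = pos (- B l k); v = pos (- B 3 k); w = pos (- B 4 k) in
      L k k + u * u * L l l + v * v * L 3 3 + w * w * L 4 4
      - u * (L k l + L l k) - v * (L k 3 + L 3 k) - w * (L k 4 + L 4 k)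
      + u * v * (L l 3 + L 3 l) + u * w * (L l 4 + L 4 l) + v * w * (L 3 4 + L 4 3))"
  unfolding mutate_Lam_def atLeastAtMost_1_4 using assms
  by (elim disjE conjE) (simp_all add: mutation_E_def Let_def algebra_simps)

lemma pos_minus: "pos (- a) = pos a - a"
  by (simp add: pos_def)

locale torus_embedding =
  fixes \<iota> :: "qtorus \<Rightarrow> 'f::division_ring"
  assumes fractions: "skew_field_of_fractions \<iota>"
begin

lemma iota_one: "\<iota> 1 = 1"
  and iota_add: "\<iota> (p + s) = \<iota> p + \<iota> s"
  and iota_mult: "\<iota> (p * s) = \<iota> p * \<iota> s"
  and iota_inj: "inj \<iota>"
  using fractions by (auto simp: skew_field_of_fractions_def)

lemma iota_zero: "\<iota> 0 = 0"
  using iota_add[of 0 0] by simp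

lemma iota_eq_iff: "\<iota> p = \<iota> s \<longleftrightarrow> p = s"
  using iota_inj by (auto dest: injD)

lemma iota_eq_zero_iff: "\<iota> p = 0 \<longleftrightarrow> p = 0"
  using iota_eq_iff[of p 0] by (simp add: iota_zero)

lemma iota_power: "\<iota> (p ^ n) = \<iota> p ^ n"
  by (induction n) (simp_all add: iota_one iota_mult)

lemma iota_sum: "\<iota> (sum f I) = (\<Sum>i\<in>I. \<iota> (f i))"
  by (induction I rule: infinite_finite_induct) (simp_all add: iota_zero iota_add)

text \<open>The monomials in a mutation have exponent \<open>-1\<close> at the mutated variable.  Multiplying by that
  variable clears the inverse, so that exchange relations can be compared inside the torus.\<close>

lemma seed_monomial_exchange:
  assumes ij: "i = 1 \<and> j = 2 \<or> i = 2 \<and> j = 1"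
    and X: "X i = \<iota> p" "X j = \<iota> s" "X 3 = \<iota> (Ymon 1 0)" "X 4 = \<iota> (Ymon 0 1)"
    and ps: "p * s = s * p" "p \<noteq> 0"
    and L: "L 1 2 = 0" "L 3 4 = - 2"
    and a: "a i = - 1" "a j = int e" "a 3 = int c" "a 4 = int d"
  shows "X i * seed_monomial \<iota> L X a =
    \<iota> (qhalf (- (int c * - L i 3) - int d * - L i 4 +
      int e * (int c * - L j 3 + int d * - L j 4)) * (s ^ e * Ymon (int c) (int d)))"
proof -
  define r where "r = - (int c * - L i 3) - int d * - L i 4 +
      int e * (int c * - L j 3 + int d * - L j 4)"
  have "\<iota> p \<noteq> 0" using ps by (simp add: iota_eq_zero_iff)
  have com: "\<iota> p * \<iota> s = \<iota> s * \<iota> p" using ps by (metis iota_mult)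
  have inv: "inverse (\<iota> p) * \<iota> s ^ e = \<iota> s ^ e * inverse (\<iota> p)"
    by (intro mult_commute_imp_mult_inverse_commute) (simp add: power_commuting_commutes com)
  have q: "- (\<Sum>i\<in>{1..4}. \<Sum>j\<in>{i<..4}. a i * a j * L i j) = r + 2 * int c * int d"
    unfolding sum_pairs_4 using ij a L by (auto simp: r_def algebra_simps)
  have y: "X 3 powi a 3 * X 4 powi a 4 = \<iota> (qhalf (- 2 * int c * int d) * Ymon (int c) (int d))"
    using y_monomial[of "int c" "int d"]
    by (simp add: X a power_int_of_nat Ymon_power flip: iota_power iota_mult)
  have x: "X 1 powi a 1 * X 2 powi a 2 = inverse (\<iota> p) * \<iota> s ^ e"
    using ij X a inv by (auto simp: power_int_of_nat power_int_minus1_right)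
  have "X i * seed_monomial \<iota> L X a = \<iota> p * \<iota> (qhalf (r + 2 * int c * int d)) *
      ((inverse (\<iota> p) * \<iota> s ^ e) * \<iota> (qhalf (- 2 * int c * int d) * Ymon (int c) (int d)))"
    unfolding seed_monomial_def q x[symmetric] y[symmetric] X(1) by (simp only: mult.assoc)
  also have "\<iota> p * \<iota> (qhalf (r + 2 * int c * int d)) = \<iota> (qhalf (r + 2 * int c * int d)) * \<iota> p"
    by (metis iota_mult qhalf_central)
  also have "\<iota> (qhalf (r + 2 * int c * int d)) * \<iota> p *
      ((inverse (\<iota> p) * \<iota> s ^ e) * \<iota> (qhalf (- 2 * int c * int d) * Ymon (int c) (int d))) =
      \<iota> (qhalf (r + 2 * int c * int d)) * ((\<iota> p * inverse (\<iota> p)) *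
      (\<iota> s ^ e * \<iota> (qhalf (- 2 * int c * int d) * Ymon (int c) (int d))))"
    by (simp only: mult.assoc)
  also have "\<dots> = \<iota> (qhalf (r + 2 * int c * int d) *
      (s ^ e * (qhalf (- 2 * int c * int d) * Ymon (int c) (int d))))"
    using \<open>\<iota> p \<noteq> 0\<close> by (simp add: iota_mult iota_power)
  also have "\<dots> = \<iota> (qhalf r * (s ^ e * Ymon (int c) (int d)))"
    by (simp add: qhalf_central_assoc[of "s ^ e"] qhalf_mult_assoc)
  finally show ?thesis by (simp only: r_def)
qed

text \<open>The quantum seed with cluster \<open>{x\<^sub>n, x\<^sub>n\<^sub>+\<^sub>1}\<close>, with \<open>x\<^sub>n\<close> at position \<open>i\<close> and \<open>x\<^sub>n\<^sub>+\<^sub>1\<close> at position \<open>j\<close>;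
  leaving the positions open avoids a case distinction on the parity of \<open>n\<close>.  The cluster variables
  commute with each other, and their \<open>\<Lambda>\<close>-pairings with the frozen variables are the negatives of the
  components of their \<open>g\<close>-vectors.\<close>

definition is_seed :: "int \<Rightarrow> nat \<Rightarrow> nat \<Rightarrow> 'f seed \<Rightarrow> bool" where
  "is_seed n i j = (\<lambda>(L, B, X).
     (i = 1 \<and> j = 2 \<or> i = 2 \<and> j = 1) \<and>
     X i = \<iota> (cvar n) \<and> X j = \<iota> (cvar (n + 1)) \<and> X 3 = \<iota> (Ymon 1 0) \<and> X 4 = \<iota> (Ymon 0 1) \<and>
     L i i = 0 \<and> L i j = 0 \<and> L i 3 = - gvec1 n \<and> L i 4 = - gvec2 n \<and>
     L j i = 0 \<and> L j j = 0 \<and> L j 3 = - gvec1 (n + 1) \<and> L j 4 = - gvec2 (n + 1) \<and>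
     L 3 i = gvec1 n \<and> L 3 j = gvec1 (n + 1) \<and> L 3 3 = 0 \<and> L 3 4 = - 2 \<and>
     L 4 i = gvec2 n \<and> L 4 j = gvec2 (n + 1) \<and> L 4 3 = 2 \<and> L 4 4 = 0 \<and>
     B i i = 0 \<and> B j i = - 2 \<and> B 3 i = frozen1 n \<and> B 4 i = frozen2 n \<and>
     B i j = 2 \<and> B j j = 0 \<and> B 3 j = - frozen1 (n - 1) \<and> B 4 j = - frozen2 (n - 1))"

lemma is_seed_initial: "is_seed 1 1 2 (Lam0, B0, X0 \<iota>)"
  by (simp add: is_seed_def X0_def Lam0_def B0_def gvec1_def gvec2_def frozen1_def frozen2_def cvar_def
      zvar_1 zvar_2)

lemma cvar_nonzero: "cvar n \<noteq> 0"
proof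
  assume "cvar n = 0"
  have "pointed 0 (gvec1 n) (gvec2 n)" using pointed_cvar[of n] \<open>cvar n = 0\<close> by simp
  from pointed_mult[OF this pointed_Xmon[of 1 0]] have "pointed 0 (gvec1 n + 1) (gvec2 n)" by simp
  from pointed_unique[OF this \<open>pointed 0 (gvec1 n) (gvec2 n)\<close>] show False by simp
qed

text \<open>The entry of the mutated form for the two variables of the new cluster is, up to sign, one of the
  following two expressions.\<close>

lemma gvec_orth_up: "pos (- frozen1 n) * gvec1 (n + 1) + pos (- frozen2 n) * gvec2 (n + 1) = 0"
proof -
  consider "n \<ge> 1" | "n = 0" | "n = - 1" | "n \<le> - 2" by linarith
  then show ?thesis by cases (simp_all add: pos_def frozen1_def frozen2_def gvec1_def gvec2_def)
qed

lemma gvec_orth_down: "pos (frozen1 n) * gvec1 (n + 1) + pos (frozen2 n) * gvec2 (n + 1) = 0"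
proof -
  consider "n \<ge> 1" | "n = 0" | "n = - 1" | "n \<le> - 2" by linarith
  then show ?thesis
    by cases (simp_all add: pos_def frozen1_def frozen2_def gvec1_def gvec2_def algebra_simps)
qed

lemma mutate_X_up:
  assumes "is_seed n i j (L, B, X)"
  shows "mutate_X \<iota> L B X i = X(i := \<iota> (cvar (n + 2)))"
proof -
  note s = assms[unfolded is_seed_def prod.case]
  have ij: "i = 1 \<and> j = 2 \<or> i = 2 \<and> j = 1" using s by blast
  define a where "a = (\<lambda>l. pos (B l i) - (if l = i then 1 else 0))"
  define a' where "a' = (\<lambda>l. pos (- B l i) - (if l = i then 1 else 0))"
  have L12: "L 1 2 = 0" and L34: "L 3 4 = - 2" using s ij by auto
  have Xs: "X i = \<iota> (cvar n)" "X j = \<iota> (cvar (n + 1))" "X 3 = \<iota> (Ymon 1 0)" "X 4 = \<iota> (Ymon 0 1)"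
    using s by auto
  have a: "a i = - 1" "a j = int 0" "a 3 = int (nat (pos (frozen1 n)))" "a 4 = int (nat (pos (frozen2 n)))"
    using s ij by (auto simp: a_def pos_def)
  have a': "a' i = - 1" "a' j = int 2" "a' 3 = int (nat (pos (- frozen1 n)))"
    "a' 4 = int (nat (pos (- frozen2 n)))"
    using s ij by (auto simp: a'_def pos_def)
  have nn: "0 \<le> pos u" for u by (simp add: pos_def)
  have "X i * seed_monomial \<iota> L X a = \<iota> (qhalf (- pos (frozen1 n) * gvec1 n - pos (frozen2 n) * gvec2 n) *
      Ymon (pos (frozen1 n)) (pos (frozen2 n)))"
    using seed_monomial_exchange[OF ij Xs cvar_commute cvar_nonzero L12 L34 a] s
    by (simp add: nn)
  moreover have "X i * seed_monomial \<iota> L X a' = \<iota> (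
      qhalf (- pos (- frozen1 n) * gvec1 n - pos (- frozen2 n) * gvec2 n +
       2 * (pos (- frozen1 n) * gvec1 (n + 1) + pos (- frozen2 n) * gvec2 (n + 1))) *
       (cvar (n + 1) ^ 2 * Ymon (pos (- frozen1 n)) (pos (- frozen2 n))))"
    using seed_monomial_exchange[OF ij Xs cvar_commute cvar_nonzero L12 L34 a'] s
    by (simp add: nn)
  ultimately have "X i * (seed_monomial \<iota> L X a + seed_monomial \<iota> L X a') = X i * \<iota> (cvar (n + 2))"
    using s cvar_exchange[of n]
    by (simp add: distrib_left add.commute flip: iota_add iota_mult)
  moreover have "X i \<noteq> 0" using s cvar_nonzero by (simp add: iota_eq_zero_iff)
  ultimately have "seed_monomial \<iota> L X a + seed_monomial \<iota> L X a' = \<iota> (cvar (n + 2))"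
    by simp
  then show ?thesis by (simp add: mutate_X_def a_def a'_def)
qed

lemma mutate_X_down:
  assumes "is_seed n i j (L, B, X)"
  shows "mutate_X \<iota> L B X j = X(j := \<iota> (cvar (n - 1)))"
proof -
  note s = assms[unfolded is_seed_def prod.case]
  define k where "k = n - 1"
  have k: "n = k + 1" "n + 1 = k + 2" by (auto simp: k_def)
  have ij: "i = 1 \<and> j = 2 \<or> i = 2 \<and> j = 1" and ji: "j = 1 \<and> i = 2 \<or> j = 2 \<and> i = 1"
    using s by blast+
  define a where "a = (\<lambda>l. pos (B l j) - (if l = j then 1 else 0))"
  define a' where "a' = (\<lambda>l. pos (- B l j) - (if l = j then 1 else 0))"
  have L12: "L 1 2 = 0" and L34: "L 3 4 = - 2" using s ij by auto
  have Xs: "X j = \<iota> (cvar (n + 1))" "X i = \<iota> (cvar n)" "X 3 = \<iota> (Ymon 1 0)" "X 4 = \<iota> (Ymon 0 1)"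
    using s by auto
  have a: "a j = - 1" "a i = int 2" "a 3 = int (nat (pos (- frozen1 k)))" "a 4 = int (nat (pos (- frozen2 k)))"
    using s ij by (auto simp: a_def pos_def k_def)
  have a': "a' j = - 1" "a' i = int 0" "a' 3 = int (nat (pos (frozen1 k)))"
    "a' 4 = int (nat (pos (frozen2 k)))"
    using s ij by (auto simp: a'_def pos_def k_def)
  have nn: "0 \<le> pos u" for u by (simp add: pos_def)
  have com: "cvar (n + 1) * cvar n = cvar n * cvar (n + 1)" by (simp add: cvar_commute)
  have "X j * seed_monomial \<iota> L X a' = \<iota> (qhalf (- pos (frozen1 k) * gvec1 (k + 2) - pos (frozen2 k) * gvec2 (k + 2)) *
      Ymon (pos (frozen1 k)) (pos (frozen2 k)))"
    using seed_monomial_exchange[OF ji Xs com cvar_nonzero L12 L34 a'] s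
    by (simp add: nn k add.commute)
  moreover have "X j * seed_monomial \<iota> L X a = \<iota> (
      qhalf (- pos (- frozen1 k) * gvec1 (k + 2) - pos (- frozen2 k) * gvec2 (k + 2) +
       2 * (pos (- frozen1 k) * gvec1 (k + 1) + pos (- frozen2 k) * gvec2 (k + 1))) *
       (cvar (k + 1) ^ 2 * Ymon (pos (- frozen1 k)) (pos (- frozen2 k))))"
    using seed_monomial_exchange[OF ji Xs com cvar_nonzero L12 L34 a] s
    by (simp add: nn k add.commute)
  ultimately have "X j * (seed_monomial \<iota> L X a + seed_monomial \<iota> L X a') = X j * \<iota> (cvar k)"
    using s cvar_exchange'[of k]
    by (simp add: k distrib_left add.commute flip: iota_add iota_mult)
  moreover have "X j \<noteq> 0" using s cvar_nonzero by (simp add: iota_eq_zero_iff)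
  ultimately have "seed_monomial \<iota> L X a + seed_monomial \<iota> L X a' = \<iota> (cvar k)"
    by simp
  then show ?thesis by (simp add: mutate_X_def a_def a'_def k_def)
qed

lemma is_seed_up:
  assumes "is_seed n i j (L, B, X)"
  shows "is_seed (n + 1) j i (mutate_Lam L B i, mutate_B B i, mutate_X \<iota> L B X i)"
proof -
  note s = assms[unfolded is_seed_def prod.case]
  have ij: "i = 1 \<and> j = 2 \<or> i = 2 \<and> j = 1" using s by blast
  have p: "pos 2 = 2" "pos (- 2) = 0" by (simp_all add: pos_def)
  have other: "mutate_Lam L B i r r' = L r r'" if "r \<in> {j, 3, 4}" "r' \<in> {j, 3, 4}" for r r'
    using that mutate_Lam_other[OF ij] by blast
  have right: "mutate_Lam L B i r i =
      - L r i + 2 * L r j + pos (- frozen1 n) * L r 3 + pos (- frozen2 n) * L r 4"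
    if "r \<in> {j, 3, 4}" for r
    using mutate_Lam_right[OF ij that, of L B] s by (simp add: p)
  have left: "mutate_Lam L B i i r =
      - L i r + 2 * L j r + pos (- frozen1 n) * L 3 r + pos (- frozen2 n) * L 4 r"
    if "r \<in> {j, 3, 4}" for r
    using mutate_Lam_left[OF ij that, of L B] s by (simp add: p)
  have "mutate_Lam L B i j i = 0" "mutate_Lam L B i i j = 0"
    using left[of j] right[of j] s gvec_orth_up[of n] by simp_all
  moreover have "mutate_Lam L B i 3 i = gvec1 (n + 2)" "mutate_Lam L B i i 3 = - gvec1 (n + 2)"
    using left[of 3] right[of 3] s unfolding gvec1_rec[of n] by simp_all
  moreover have "mutate_Lam L B i 4 i = gvec2 (n + 2)" "mutate_Lam L B i i 4 = - gvec2 (n + 2)"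
    using left[of 4] right[of 4] s unfolding gvec2_rec[of n] by simp_all
  moreover have "mutate_Lam L B i i i = 0"
    using mutate_Lam_diag[OF ij, of L B] s by (simp add: p Let_def)
  moreover have "mutate_B B i r i = - B r i" "mutate_B B i i r = - B i r" for r
    by (simp_all add: mutate_B_def)
  moreover have "mutate_B B i 3 j = frozen1 (n + 1)" "mutate_B B i 4 j = frozen2 (n + 1)"
    "mutate_B B i j j = 0"
    using s ij p unfolding frozen1_rec[of n] frozen2_rec[of n] by (auto simp: mutate_B_def)
  moreover have "i \<noteq> j" "i \<noteq> 3" "i \<noteq> 4" using ij by auto
  moreover have "j = 1 \<and> i = 2 \<or> j = 2 \<and> i = 1" using ij by auto
  ultimately show ?thesis
    unfolding mutate_X_up[OF assms] is_seed_def prod.case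
    using s other by (simp add: add.commute)
qed

lemma is_seed_down:
  assumes "is_seed n i j (L, B, X)"
  shows "is_seed (n - 1) j i (mutate_Lam L B j, mutate_B B j, mutate_X \<iota> L B X j)"
proof -
  note s = assms[unfolded is_seed_def prod.case]
  have ji: "j = 1 \<and> i = 2 \<or> j = 2 \<and> i = 1" using s by blast
  have n1: "n - 1 + 2 = n + 1" by simp
  have p: "pos 2 = 2" "pos (- 2) = 0" by (simp_all add: pos_def)
  have other: "mutate_Lam L B j r r' = L r r'" if "r \<in> {i, 3, 4}" "r' \<in> {i, 3, 4}" for r r'
    using that mutate_Lam_other[OF ji] by blast
  have right: "mutate_Lam L B j r j =
      - L r j + pos (frozen1 (n - 1)) * L r 3 + pos (frozen2 (n - 1)) * L r 4"
    if "r \<in> {i, 3, 4}" for r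
    using mutate_Lam_right[OF ji that, of L B] s by (simp add: p)
  have left: "mutate_Lam L B j j r =
      - L j r + pos (frozen1 (n - 1)) * L 3 r + pos (frozen2 (n - 1)) * L 4 r"
    if "r \<in> {i, 3, 4}" for r
    using mutate_Lam_left[OF ji that, of L B] s by (simp add: p)
  have "mutate_Lam L B j j i = 0" "mutate_Lam L B j i j = 0"
    using left[of i] right[of i] s gvec_orth_down[of "n - 1"] by simp_all
  moreover have "mutate_Lam L B j 3 j = gvec1 (n - 1)" "mutate_Lam L B j j 3 = - gvec1 (n - 1)"
    using left[of 3] right[of 3] s gvec1_rec'[of "n - 1", unfolded n1] by simp_all
  moreover have "mutate_Lam L B j 4 j = gvec2 (n - 1)" "mutate_Lam L B j j 4 = - gvec2 (n - 1)"
    using left[of 4] right[of 4] s gvec2_rec'[of "n - 1", unfolded n1] by simp_all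
  moreover have "mutate_Lam L B j j j = 0"
    using mutate_Lam_diag[OF ji, of L B] s by (simp add: p Let_def)
  moreover have "mutate_B B j r j = - B r j" "mutate_B B j j r = - B j r" for r
    by (simp_all add: mutate_B_def)
  moreover have "mutate_B B j r i = B r i - 2 * pos (B r j) + 2 * B r j" if "r \<in> {3, 4}" for r
  proof -
    have "r \<noteq> j" "i \<noteq> j" "B j i = - 2" using that ji s by auto
    then show ?thesis using p by (simp add: mutate_B_def)
  qed
  then have "mutate_B B j 3 i = - frozen1 (n - 2)" "mutate_B B j 4 i = - frozen2 (n - 2)"
    using s frozen1_rec[of "n - 1"] frozen2_rec[of "n - 1"]
      pos_minus[of "frozen1 (n - 1)"] pos_minus[of "frozen2 (n - 1)"] by simp_all
  moreover have "mutate_B B j i i = 0"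
    using s ji p by (auto simp: mutate_B_def)
  moreover have "i \<noteq> j" "j \<noteq> 3" "j \<noteq> 4" using ji by auto
  moreover note ji
  ultimately show ?thesis
    unfolding mutate_X_down[OF assms] is_seed_def prod.case
    using s other by (simp add: add.commute)
qed

end

context torus_embedding
begin

text \<open>Since the variables of a cluster commute and \<open>\<Lambda>\<close> pairs them to 0, the normalized monomial is the plain
  product.\<close>

lemma seed_monomial_cluster:
  assumes "is_seed n i j (L, B, X)"
  shows "seed_monomial \<iota> L X (coord (int a1, int a2, 0, 0)) =
    (if i = 1 then \<iota> (cmono n a1 a2) else \<iota> (cmono n a2 a1))"
proof -
  note s = assms[unfolded is_seed_def prod.case]
  have "L 1 2 = 0" using s by auto
  then have "seed_monomial \<iota> L X (coord (int a1, int a2, 0, 0)) = X 1 ^ a1 * X 2 ^ a2"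
    unfolding seed_monomial_def sum_pairs_4 by (simp add: qhalf_0 iota_one)
  moreover have "cvar (n + 1) ^ a1 * cvar n ^ a2 = cvar n ^ a2 * cvar (n + 1) ^ a1"
    by (intro power_commuting_commutes power_commuting_commutes[symmetric])
      (simp add: cvar_commute)
  ultimately show ?thesis
    using s by (auto simp: cmono_def simp flip: iota_power iota_mult)
qed

lemma seeds_classified:
  assumes "(L, B, X) \<in> seeds \<iota>"
  shows "\<exists>n i j. is_seed n i j (L, B, X)"
  using assms
proof (induction rule: seeds.induct)
  case initial
  show ?case using is_seed_initial by blast
next
  case (mutation L B X k)
  then obtain n i j where s: "is_seed n i j (L, B, X)" by blast
  then have "k = i \<or> k = j" using mutation.hyps s by (auto simp: is_seed_def)
  then show ?case using is_seed_up[OF s] is_seed_down[OF s] by blast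
qed

lemma seed_exists: "\<exists>i j. \<exists>S\<in>seeds \<iota>. is_seed n i j S"
proof (induction n rule: int_induct[where k = 1])
  case base
  show ?case using is_seed_initial seeds.initial by blast
next
  case (step1 n)
  then obtain i j L B X where s: "(L, B, X) \<in> seeds \<iota>" "is_seed n i j (L, B, X)" by auto
  moreover from s have "i \<in> {1, 2}" by (auto simp: is_seed_def)
  ultimately show ?case using is_seed_up seeds.mutation by blast
next
  case (step2 n)
  then obtain i j L B X where s: "(L, B, X) \<in> seeds \<iota>" "is_seed n i j (L, B, X)" by auto
  moreover from s have "j \<in> {1, 2}" by (auto simp: is_seed_def)
  ultimately show ?case using is_seed_down seeds.mutation by blast
qed

lemma cluster_variables_eq: "cluster_variables \<iota> = \<iota> ` range cvar"
proof
  show "cluster_variables \<iota> \<subseteq> \<iota> ` range cvar"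
  proof
    fix x assume "x \<in> cluster_variables \<iota>"
    then obtain L B X k where "x = X k" "(L, B, X) \<in> seeds \<iota>" "k = 1 \<or> k = 2"
      by (auto simp: cluster_variables_def)
    moreover then obtain n i j where "is_seed n i j (L, B, X)" using seeds_classified by blast
    ultimately show "x \<in> \<iota> ` range cvar" by (auto simp: is_seed_def)
  qed
  show "\<iota> ` range cvar \<subseteq> cluster_variables \<iota>"
  proof clarify
    fix n
    obtain i j L B X where s: "(L, B, X) \<in> seeds \<iota>" "is_seed n i j (L, B, X)"
      using seed_exists[of n] by auto
    then have "i \<in> {1, 2}" "\<iota> (cvar n) = X i" by (auto simp: is_seed_def)
    then show "\<iota> (cvar n) \<in> cluster_variables \<iota>"
      unfolding cluster_variables_def using s by blast
  qed
qed

lemma cluster_monomials_eq: "cluster_monomials \<iota> = \<iota> ` {cmono n a b | n a b. True}"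
proof
  show "cluster_monomials \<iota> \<subseteq> \<iota> ` {cmono n a b | n a b. True}"
  proof
    fix x assume "x \<in> cluster_monomials \<iota>"
    then obtain L B X a1 a2 where x: "x = seed_monomial \<iota> L X (coord (int a1, int a2, 0, 0))"
      "(L, B, X) \<in> seeds \<iota>"
      by (auto simp: cluster_monomials_def)
    then obtain n i j where "is_seed n i j (L, B, X)" using seeds_classified by blast
    from seed_monomial_cluster[OF this] show "x \<in> \<iota> ` {cmono n a b | n a b. True}"
      unfolding x(1) by (cases "i = 1") auto
  qed
  show "\<iota> ` {cmono n a b | n a b. True} \<subseteq> cluster_monomials \<iota>"
  proof clarify
    fix n and a b :: nat
    obtain i j L B X where s: "(L, B, X) \<in> seeds \<iota>" "is_seed n i j (L, B, X)"
      using seed_exists[of n] by auto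
    define a1 a2 where "a1 = (if i = 1 then a else b)" and "a2 = (if i = 1 then b else a)"
    have "\<iota> (cmono n a b) = seed_monomial \<iota> L X (coord (int a1, int a2, 0, 0))"
      using seed_monomial_cluster[OF s(2), of a1 a2] by (simp add: a1_def a2_def)
    then show "\<iota> (cmono n a b) \<in> cluster_monomials \<iota>"
      unfolding cluster_monomials_def using s(1) by blast
  qed
qed

lemma basis_S_eq: "basis_S \<iota> = \<iota> ` standard"
proof -
  have "Sn n \<in> {cmono n a b | n a b. True} \<union> {Sn n | n. n \<ge> 1}" for n
  proof (cases n)
    case 0
    then have "Sn n = cmono 0 0 0" by (simp add: cmono_def)
    then show ?thesis by blast
  qed auto
  then have st: "standard = {cmono n a b | n a b. True} \<union> {Sn n | n. n \<ge> 1}"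
    unfolding standard_def by blast
  show ?thesis
    unfolding basis_S_def cluster_monomials_eq st by blast
qed

end


section \<open>The basis of the cluster algebra\<close>

lemma left_comb_superset:
  "Poly_Mapping.keys c \<subseteq> K \<Longrightarrow> finite K \<Longrightarrow> \<iota> 0 = 0 \<Longrightarrow>
    left_comb \<iota> c = (\<Sum>s\<in>K. \<iota> (Poly_Mapping.lookup c s) * s)"
  unfolding left_comb_def by (rule sum.mono_neutral_left) (auto simp: in_keys_iff)

context torus_embedding
begin

lemma left_comb_add: "left_comb \<iota> (c + d) = left_comb \<iota> c + left_comb \<iota> d"
proof -
  let ?K = "Poly_Mapping.keys c \<union> Poly_Mapping.keys d"
  have "Poly_Mapping.keys (c + d) \<subseteq> ?K" by (rule Poly_Mapping.keys_add)
  then show ?thesis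
    using left_comb_superset[of c ?K \<iota>] left_comb_superset[of d ?K \<iota>]
      left_comb_superset[of "c + d" ?K \<iota>]
    by (simp add: iota_zero lookup_add iota_add distrib_right sum.distrib)
qed

lemma left_comb_single: "left_comb \<iota> (Poly_Mapping.single s c) = \<iota> c * s"
  using left_comb_superset[of "Poly_Mapping.single s c" "{s}" \<iota>]
  by (simp add: iota_zero)

definition combinations :: "qtorus set \<Rightarrow> 'f set" where
  "combinations R = left_comb \<iota> ` left_coeffs R (\<iota> ` standard)"

lemma combinations_add:
  assumes "\<And>c d. c \<in> R \<Longrightarrow> d \<in> R \<Longrightarrow> c + d \<in> R" "x \<in> combinations R" "y \<in> combinations R"
  shows "x + y \<in> combinations R"
proof -
  obtain c d where c: "c \<in> left_coeffs R (\<iota> ` standard)" "x = left_comb \<iota> c"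
    and d: "d \<in> left_coeffs R (\<iota> ` standard)" "y = left_comb \<iota> d"
    using assms(2,3) by (auto simp: combinations_def)
  have "c + d \<in> left_coeffs R (\<iota> ` standard)"
    using c(1) d(1) Poly_Mapping.keys_add[of c d] assms(1)
    by (auto simp: left_coeffs_def lookup_add)
  then show ?thesis
    unfolding combinations_def c(2) d(2) left_comb_add[symmetric] by blast
qed

lemma combinations_single:
  assumes "0 \<in> R" "c \<in> R" "s \<in> standard"
  shows "\<iota> c * \<iota> s \<in> combinations R"
proof -
  have "Poly_Mapping.single (\<iota> s) c \<in> left_coeffs R (\<iota> ` standard)"
    using assms by (auto simp: left_coeffs_def lookup_single when_def)
  then show ?thesis
    unfolding combinations_def using left_comb_single by (metis imageI)
qed

lemma combinations_zero: "0 \<in> R \<Longrightarrow> 0 \<in> combinations R"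
  unfolding combinations_def
  by (rule image_eqI[of _ _ 0]) (auto simp: left_comb_def left_coeffs_def)

end

lemma coeff_ring_add: "c \<in> coeff_ring \<Longrightarrow> d \<in> coeff_ring \<Longrightarrow> c + d \<in> coeff_ring"
  using Poly_Mapping.keys_add[of c d] by (auto simp: coeff_ring_def)

lemma coeff_ring_uminus: "c \<in> coeff_ring \<Longrightarrow> - c \<in> coeff_ring"
  by (simp add: coeff_ring_def)

lemma coeff_ring_mult: "c \<in> coeff_ring \<Longrightarrow> d \<in> coeff_ring \<Longrightarrow> c * d \<in> coeff_ring"
  using keys_mult[of c d] by (fastforce simp: coeff_ring_def vexp_add coord_add)

lemma coeff_ring_zero: "0 \<in> coeff_ring"
  by (simp add: coeff_ring_def)

lemma coeff_ring_monomial: "Poly_Mapping.single (QMon r (0, 0, c, d)) n \<in> coeff_ring"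
  by (auto simp: coeff_ring_def)

lemma coeff_ring_unit: "qhalf r * Ymon c d \<in> coeff_ring"
  unfolding qhalf_Xmon by (rule coeff_ring_monomial)

lemma coeff_ring_nonneg_unit: "qhalf r * Ymon c d \<in> coeff_ring_nonneg"
  using coeff_ring_unit[of r c d]
  by (auto simp: coeff_ring_nonneg_def qhalf_Xmon lookup_single when_def)

lemma coeff_ring_nonneg_zero: "0 \<in> coeff_ring_nonneg"
  by (simp add: coeff_ring_nonneg_def coeff_ring_zero)

lemma coeff_ring_nonneg_add:
  "c \<in> coeff_ring_nonneg \<Longrightarrow> d \<in> coeff_ring_nonneg \<Longrightarrow> c + d \<in> coeff_ring_nonneg"
  by (auto simp: coeff_ring_nonneg_def coeff_ring_add lookup_add)

lemma coeff_ring_one: "1 \<in> coeff_ring"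
  using coeff_ring_unit[of 0 0 0] by (simp add: torus_simps)

text \<open>Summing up an element term by term never leaves the coefficient ring, so only its monomials have to
  be considered.\<close>

lemma coeff_ring_induct [consumes 1, case_names zero monomial add]:
  assumes "p \<in> coeff_ring" and "P 0"
    and monomial: "\<And>r c d n. P (Poly_Mapping.single (QMon r (0, 0, c, d)) n)"
    and add: "\<And>p s. P p \<Longrightarrow> P s \<Longrightarrow> P (p + s)"
  shows "P p"
  using assms(1)
proof (induction p rule: update_induct)
  case const
  show ?case by (rule assms(2))
next
  case (update f m n)
  have sum: "Poly_Mapping.update m n f = f + Poly_Mapping.single m n"
    using update(1) by (intro poly_mapping_eqI)
      (auto simp: lookup_update lookup_add lookup_single when_def in_keys_iff)
  have "Poly_Mapping.keys (Poly_Mapping.update m n f) = insert m (Poly_Mapping.keys f)"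
    using update(2) by (simp add: keys_update)
  then have "f \<in> coeff_ring" "coord (vexp m) 1 = 0" "coord (vexp m) 2 = 0"
    using update.prems by (auto simp: coeff_ring_def)
  then have "P f" "P (Poly_Mapping.single m n)"
    using update(3) monomial[of "qexp m" _ _ n] by (cases m; cases "vexp m"; auto)+
  then show ?case unfolding sum by (rule add)
qed

text \<open>The coefficients need not commute with a homogeneous element, but moving them past it only
  changes them by powers of \<open>q\<close>.\<close>

lemma homogeneous_normalizes:
  assumes "homogeneous \<alpha> \<beta> s" "d \<in> coeff_ring"
  shows "\<exists>d'\<in>coeff_ring. s * d = d' * s"
  using assms(2)
proof (induction d rule: coeff_ring_induct)
  case zero
  show ?case by (intro bexI[of _ 0]) (simp_all add: coeff_ring_zero)
next
  case (monomial r c d n)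
  have mono: "Poly_Mapping.single (QMon r' (0, 0, c, d)) n = of_int n * (qhalf r' * Ymon c d)" for r'
    by (simp add: qhalf_Xmon mult_single flip: single_of_int zero_qmon_def)
  have "s * (of_int n * (qhalf r * Ymon c d)) = of_int n * (qhalf r * (s * Ymon c d))"
    unfolding mult.assoc[symmetric] mult_of_int_commute[of n s, symmetric]
    unfolding mult.assoc qhalf_central_assoc[of s] ..
  also have "\<dots> = of_int n * (qhalf (r + - 2 * (c * \<alpha> + d * \<beta>)) * Ymon c d) * s"
    by (simp add: homogeneous_swap[OF assms(1)] qhalf_mult_assoc mult.assoc)
  finally show ?case
    unfolding mono using coeff_ring_monomial[of _ c d n, unfolded mono] by blast
next
  case (add p t)
  then show ?case by (metis coeff_ring_add distrib_left distrib_right)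
qed

context torus_embedding
begin

lemma cone_combinations: "p \<in> cone standard \<Longrightarrow> \<iota> p \<in> combinations coeff_ring_nonneg"
proof (induction p rule: cone.induct)
  case zero
  show ?case by (simp add: iota_zero combinations_zero coeff_ring_nonneg_zero)
next
  case (add g p r c d)
  then show ?case
    using combinations_add[OF coeff_ring_nonneg_add
        combinations_single[OF coeff_ring_nonneg_zero coeff_ring_nonneg_unit[of r c d] add(1)]]
    by (simp add: iota_add iota_mult mult.assoc)
qed

lemma left_coeffs_nonneg: "left_coeffs coeff_ring_nonneg B \<subseteq> left_coeffs coeff_ring B"
  by (auto simp: left_coeffs_def coeff_ring_nonneg_def)

lemma left_comb_independent:
  assumes "c \<in> left_coeffs coeff_ring (\<iota> ` standard)" "left_comb \<iota> c = 0"
  shows "c = 0"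
proof -
  define F where "F = {s \<in> standard. \<iota> s \<in> Poly_Mapping.keys c}"
  have keys: "Poly_Mapping.keys c = \<iota> ` F"
    using assms(1) by (auto simp: F_def left_coeffs_def)
  have inj: "inj_on \<iota> F" using iota_inj by (auto intro: inj_on_subset)
  have "finite F" using finite_keys[of c] unfolding keys by (rule finite_imageD[OF _ inj])
  have "\<iota> (\<Sum>s\<in>F. Poly_Mapping.lookup c (\<iota> s) * s) = left_comb \<iota> c"
    unfolding left_comb_def keys sum.reindex[OF inj] by (simp add: iota_sum iota_mult)
  then have "(\<Sum>s\<in>F. Poly_Mapping.lookup c (\<iota> s) * s) = 0"
    using assms(2) by (simp add: iota_eq_zero_iff)
  then have "Poly_Mapping.lookup c (\<iota> s) = 0" if "s \<in> F" for s
    using standard_independent[OF \<open>finite F\<close>, of "\<lambda>s. Poly_Mapping.lookup c (\<iota> s)"] assms(1) that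
    by (auto simp: F_def left_coeffs_def)
  then have "Poly_Mapping.keys c = {}" using keys by (auto simp: in_keys_iff)
  then show ?thesis by simp
qed

lemma left_comb_inj:
  assumes "c \<in> left_coeffs coeff_ring (\<iota> ` standard)" "d \<in> left_coeffs coeff_ring (\<iota> ` standard)"
    "left_comb \<iota> c = left_comb \<iota> d"
  shows "c = d"
proof -
  have "Poly_Mapping.keys (c - d) \<subseteq> \<iota> ` standard"
  proof -
    have "Poly_Mapping.keys (c - d) \<subseteq> Poly_Mapping.keys c \<union> Poly_Mapping.keys d"
      by (auto simp: in_keys_iff lookup_minus)
    then show ?thesis using assms(1,2) by (auto simp: left_coeffs_def)
  qed
  moreover have "Poly_Mapping.lookup (c - d) s \<in> coeff_ring" if "s \<in> \<iota> ` standard" for s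
    using assms(1,2) that coeff_ring_add[OF _ coeff_ring_uminus]
    by (fastforce simp: left_coeffs_def lookup_minus)
  ultimately have "c - d \<in> left_coeffs coeff_ring (\<iota> ` standard)"
    by (auto simp: left_coeffs_def)
  moreover have "left_comb \<iota> (c - d) = 0"
    using left_comb_add[of "c - d" d] assms(3) by simp
  ultimately have "c - d = 0" by (rule left_comb_independent)
  then show ?thesis by simp
qed

lemma combinations_elem_add:
  "x \<in> combinations coeff_ring \<Longrightarrow> y \<in> combinations coeff_ring \<Longrightarrow> x + y \<in> combinations coeff_ring"
  by (rule combinations_add[OF coeff_ring_add])

lemma combinations_sum:
  "(\<And>i. i \<in> I \<Longrightarrow> f i \<in> combinations coeff_ring) \<Longrightarrow> sum f I \<in> combinations coeff_ring"
  by (induction I rule: infinite_finite_induct)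
    (auto intro: combinations_elem_add combinations_zero coeff_ring_zero)

text \<open>The summation index ranges over the skew-field because \<open>left_comb\<close> sums over basis elements.\<close>

lemma combinations_induct [consumes 1, case_names sum single]:
  assumes "x \<in> combinations coeff_ring"
    and "\<And>(I :: 'f set) f. (\<And>i. i \<in> I \<Longrightarrow> P (f i)) \<Longrightarrow> P (sum f I)"
    and "\<And>c s. c \<in> coeff_ring \<Longrightarrow> s \<in> standard \<Longrightarrow> P (\<iota> c * \<iota> s)"
  shows "P x"
proof -
  obtain c where c: "c \<in> left_coeffs coeff_ring (\<iota> ` standard)" "x = left_comb \<iota> c"
    using assms(1) by (auto simp: combinations_def)
  show ?thesis
    unfolding c(2) left_comb_def
    by (rule assms(2)) (use c(1) assms(3) in \<open>auto simp: left_coeffs_def\<close>)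
qed

lemma combinations_coeff:
  assumes "x \<in> combinations coeff_ring" "c \<in> coeff_ring"
  shows "\<iota> c * x \<in> combinations coeff_ring"
  using assms(1)
proof (induction x rule: combinations_induct)
  case (sum I f)
  then show ?case by (simp add: sum_distrib_left combinations_sum)
next
  case (single d s)
  then show ?case
    using combinations_single[OF coeff_ring_zero coeff_ring_mult[OF assms(2) single(1)] single(2)]
    by (simp add: iota_mult mult.assoc)
qed

text \<open>Move the second coefficient past the first basis element, then expand the product of the two basis
  elements by \<open>standard_mult\<close>.\<close>

lemma combinations_mult:
  assumes "x \<in> combinations coeff_ring" "y \<in> combinations coeff_ring"
  shows "x * y \<in> combinations coeff_ring"
  using assms(1)
proof (induction x rule: combinations_induct)
  case (sum I f)
  then show ?case by (simp add: sum_distrib_right combinations_sum)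
next
  case (single c s)
  show ?case
    using assms(2)
  proof (induction y rule: combinations_induct)
    case (sum I f)
    then show ?case by (simp add: sum_distrib_left combinations_sum)
  next
    case t: (single d t)
    obtain d' where d': "d' \<in> coeff_ring" "s * d = d' * s"
      using homogeneous_standard[OF single(2)] homogeneous_normalizes[OF _ t(1)] by blast
    have "\<iota> c * \<iota> s * (\<iota> d * \<iota> t) = \<iota> (c * (s * d) * t)"
      by (simp add: iota_mult mult.assoc)
    also have "\<dots> = \<iota> (c * d') * \<iota> (s * t)"
      unfolding d'(2) by (simp add: iota_mult mult.assoc)
    also have "\<dots> \<in> combinations coeff_ring"
      using cone_combinations[OF standard_mult[OF single(2) t(2)]] left_coeffs_nonneg
      by (intro combinations_coeff coeff_ring_mult single(1) d'(1)) (auto simp: combinations_def)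
    finally show ?case .
  qed
qed

lemma cvar_in_algebra: "\<iota> (cvar m) \<in> cluster_algebra \<iota>"
  by (intro cluster_algebra.variable) (auto simp: cluster_variables_eq)

lemma algebra_one: "1 \<in> cluster_algebra \<iota>"
  using cluster_algebra.coeff[OF coeff_ring_one, of \<iota>] by (simp add: iota_one)

lemma algebra_power: "x \<in> cluster_algebra \<iota> \<Longrightarrow> x ^ n \<in> cluster_algebra \<iota>"
  by (induction n) (auto intro: algebra_one cluster_algebra.mult)

lemma algebra_sum:
  assumes "\<And>i. i \<in> I \<Longrightarrow> f i \<in> cluster_algebra \<iota>"
  shows "sum f I \<in> cluster_algebra \<iota>"
proof -
  have "0 \<in> cluster_algebra \<iota>"
    using cluster_algebra.coeff[OF coeff_ring_zero, of \<iota>] by (simp add: iota_zero)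
  then show ?thesis
    using assms by (induction I rule: infinite_finite_induct) (auto intro: cluster_algebra.add)
qed

text \<open>Solve \<open>z\<^sub>1 z\<^sub>4 = z\<^sub>2 z\<^sub>3 + q\<^sup>-\<^sup>1\<^sup>/\<^sup>2 y\<^sub>1 X\<^sub>\<delta>\<close> for \<open>X\<^sub>\<delta>\<close>; for positive indices \<open>z\<^sub>m\<close> is the cluster variable \<open>x\<^sub>m\<close>.\<close>

lemma X_delta_in_algebra: "\<iota> X_delta \<in> cluster_algebra \<iota>"
proof -
  have "zvar 1 * zvar 4 = zvar 2 * zvar 3 + qhalf (- 1) * (Ymon 1 0 * X_delta)"
    using zvar_mult_far[of 1 1] by simp
  then have "cvar 1 * cvar 4 = cvar 2 * cvar 3 + qhalf (- 1) * (Ymon 1 0 * X_delta)"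
    by (simp add: cvar_def)
  then have "X_delta = qhalf 1 * Ymon (-1) 0 * (cvar 1 * cvar 4 + - 1 * (cvar 2 * cvar 3))"
    by (simp add: torus_simps)
  moreover have "\<iota> \<dots> \<in> cluster_algebra \<iota>"
    unfolding iota_mult[of "qhalf 1 * Ymon (-1) 0"] iota_add iota_mult[of "cvar _"] iota_mult[of "- 1"]
    by (intro cluster_algebra.mult cluster_algebra.add cvar_in_algebra cluster_algebra.coeff
        coeff_ring_unit coeff_ring_uminus coeff_ring_one)
  ultimately show ?thesis by simp
qed

lemma Sn_in_algebra: "\<iota> (Sn n) \<in> cluster_algebra \<iota>"
proof (induction n rule: induct_nat_012)
  case 0
  show ?case by (simp add: iota_one algebra_one)
next
  case 1
  show ?case by (simp add: X_delta_in_algebra)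
next
  case (ge2 n)
  have "H \<in> coeff_ring" using coeff_ring_unit[of 0 1 1] by (simp add: qhalf_0)
  then have H: "\<iota> (- H) \<in> cluster_algebra \<iota>" by (intro cluster_algebra.coeff coeff_ring_uminus)
  have "\<iota> (Sn (Suc (Suc n))) = \<iota> (Sn (Suc n)) * \<iota> X_delta + \<iota> (- H) * \<iota> (Sn n)"
    by (simp flip: iota_mult iota_add)
  also have "\<dots> \<in> cluster_algebra \<iota>"
    by (intro cluster_algebra.add cluster_algebra.mult ge2 H X_delta_in_algebra)
  finally show ?case .
qed

lemma standard_in_algebra: "s \<in> standard \<Longrightarrow> \<iota> s \<in> cluster_algebra \<iota>"
  by (auto simp: standard_def cmono_def iota_mult iota_power
      intro!: Sn_in_algebra cvar_in_algebra algebra_power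
      intro: cluster_algebra.mult[OF algebra_power algebra_power])

lemma cmono_in_combinations: "\<iota> (cmono m a b) \<in> combinations coeff_ring"
  using combinations_single[OF coeff_ring_zero coeff_ring_one, of "cmono m a b"]
  by (auto simp: standard_def iota_one)

lemma cluster_algebra_eq: "cluster_algebra \<iota> = combinations coeff_ring"
proof
  show "cluster_algebra \<iota> \<subseteq> combinations coeff_ring"
  proof
    fix x assume "x \<in> cluster_algebra \<iota>"
    then show "x \<in> combinations coeff_ring"
    proof induction
      case (coeff c)
      have "1 \<in> combinations coeff_ring"
        using cmono_in_combinations[of 0 0 0] by (simp add: cmono_def iota_one)
      from combinations_coeff[OF this coeff] show ?case by simp
    next
      case (variable x)
      then obtain m where "x = \<iota> (cmono m 1 0)"
        by (auto simp: cluster_variables_eq cmono_def)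
      then show ?case using cmono_in_combinations by simp
    qed (auto intro: combinations_elem_add combinations_mult)
  qed
  show "combinations coeff_ring \<subseteq> cluster_algebra \<iota>"
  proof
    fix x assume "x \<in> combinations coeff_ring"
    then show "x \<in> cluster_algebra \<iota>"
      by (induction x rule: combinations_induct)
        (auto intro: algebra_sum cluster_algebra.mult cluster_algebra.coeff standard_in_algebra)
  qed
qed

lemma bar_standard:
  assumes "s \<in> standard"
  shows "bar s = s"
proof -
  have bar_power: "bar (p ^ n) = bar p ^ n" for p n
    by (induction n) (simp_all add: bar_one bar_mult power_commutes)
  have "bar (cmono m a b) = cmono m a b" for m a b
  proof -
    have "cvar (m + 1) ^ b * cvar m ^ a = cvar m ^ a * cvar (m + 1) ^ b"
      by (intro power_commuting_commutes power_commuting_commutes[symmetric])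
        (simp add: cvar_commute)
    then show ?thesis by (simp add: cmono_def bar_mult bar_power bar_cvar)
  qed
  then show ?thesis using assms bar_Sn by (auto simp: standard_def)
qed

end

theorem theorem4p3:
  fixes \<iota> :: "qtorus \<Rightarrow> 'f::division_ring"
  assumes "skew_field_of_fractions \<iota>"
  shows "cluster_monomials \<iota> \<inter> {\<iota> (Sn n) | n. n \<ge> 1} = {} \<and>
    is_left_basis \<iota> coeff_ring (basis_S \<iota>) (cluster_algebra \<iota>) \<and>
    (\<forall>s\<in>basis_S \<iota>. bar_invariant \<iota> s) \<and>
    structure_constants \<iota> coeff_ring (basis_S \<iota>) \<subseteq> coeff_ring_nonneg"
proof -
  interpret torus_embedding \<iota> by unfold_locales (rule assms)
  have "cluster_monomials \<iota> \<inter> {\<iota> (Sn n) | n. n \<ge> 1} = {}"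
    unfolding cluster_monomials_eq using cmono_neq_Sn by (auto simp: iota_eq_iff)
  moreover have "is_left_basis \<iota> coeff_ring (basis_S \<iota>) (cluster_algebra \<iota>)"
    unfolding is_left_basis_def basis_S_eq
    using standard_in_algebra left_comb_independent cluster_algebra_eq
    by (auto simp: combinations_def)
  moreover have "\<forall>s\<in>basis_S \<iota>. bar_invariant \<iota> s"
    unfolding basis_S_eq bar_invariant_def using bar_standard by auto
  moreover have "structure_constants \<iota> coeff_ring (basis_S \<iota>) \<subseteq> coeff_ring_nonneg"
  proof
    fix z assume "z \<in> structure_constants \<iota> coeff_ring (basis_S \<iota>)"
    then obtain c s t u where z: "z = Poly_Mapping.lookup c u" "u \<in> \<iota> ` standard"
      and st: "s \<in> standard" "t \<in> standard"
      and c: "c \<in> left_coeffs coeff_ring (\<iota> ` standard)" "left_comb \<iota> c = \<iota> s * \<iota> t"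
      unfolding structure_constants_def basis_S_eq by blast
    obtain d where d: "d \<in> left_coeffs coeff_ring_nonneg (\<iota> ` standard)" "left_comb \<iota> d = \<iota> s * \<iota> t"
      using cone_combinations[OF standard_mult[OF st]] by (auto simp: combinations_def iota_mult)
    (* By uniqueness, the given expansion is the nonnegative one. *)
    have "c = d"
      using left_comb_inj c d left_coeffs_nonneg by (metis subsetD)
    then show "z \<in> coeff_ring_nonneg"
      using z d(1) by (auto simp: left_coeffs_def)
  qed
  ultimately show ?thesis by blast
qed

end
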